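(* $IR(3,\mathbb F_2)$ is homotopy equivalent to a wedge of eight $3$-spheres: $$|IR(3,\mathbb F_2)|\simeq\bigvee_8 S^3.$$
   Context: A binary matroid (a matroid representable over $\mathbb F_2$) is regular if it has no minor isomorphic to the Fano matroid $F_7$ (the linear matroid on the seven nonzero vectors of $\mathbb F_2^3$) or to its dual $F_7^*$. Subsets of $\mathbb F_2^r$ are regarded as matroids under linear independence over $\mathbb F_2$. $IR(r,\mathbb F_2)$ is the poset, ordered by inclusion, of all subsets of $\mathbb F_2^r\setminus\{0\}$ which are regular matroids of rank $r$. The geometric realization $|P|$ of a poset $P$ is the geometric realization of its order complex (simplices are finite chains $x_0<\cdots<x_k$). *)

theory Defs
  imports "HOL-Analysis.Analysis" "HOL-Library.Z2"
begin

section \<open>Matroids\<close>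

record 'a matroid =
  ground :: "'a set"
  indep :: "'a set set"

definition is_matroid :: "'a matroid \<Rightarrow> bool" where
  "is_matroid M \<longleftrightarrow>
     finite (ground M) \<and>
     (\<forall>I\<in>indep M. I \<subseteq> ground M) \<and>
     {} \<in> indep M \<and>
     (\<forall>I\<in>indep M. \<forall>J. J \<subseteq> I \<longrightarrow> J \<in> indep M) \<and>
     (\<forall>I\<in>indep M. \<forall>J\<in>indep M. card I < card J \<longrightarrow> (\<exists>x\<in>J - I. insert x I \<in> indep M))"

text \<open>The bases of a subset \<open>X\<close> of the ground set, i.e. the maximal independent subsets of \<open>X\<close>.\<close>

definition bases_of :: "'a matroid \<Rightarrow> 'a set \<Rightarrow> 'a set set" where
  "bases_of M X = {B \<in> indep M. B \<subseteq> X \<and> (\<forall>I\<in>indep M. B \<subseteq> I \<and> I \<subseteq> X \<longrightarrow> I = B)}"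

definition matroid_rank :: "'a matroid \<Rightarrow> nat" where
  "matroid_rank M = Max (card ` indep M)"

definition dual_matroid :: "'a matroid \<Rightarrow> 'a matroid" where
  "dual_matroid M =
     \<lparr>ground = ground M, indep = {I. I \<subseteq> ground M \<and> (\<exists>B\<in>bases_of M (ground M). I \<inter> B = {})}\<rparr>"

definition delete_matroid :: "'a matroid \<Rightarrow> 'a set \<Rightarrow> 'a matroid" where
  "delete_matroid M X =
     \<lparr>ground = ground M - X, indep = {I \<in> indep M. I \<subseteq> ground M - X}\<rparr>"

definition contract_matroid :: "'a matroid \<Rightarrow> 'a set \<Rightarrow> 'a matroid" where
  "contract_matroid M X =
     \<lparr>ground = ground M - X,
      indep = {I. I \<subseteq> ground M - X \<and> (\<exists>B\<in>bases_of M X. I \<union> B \<in> indep M)}\<rparr>"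

definition is_minor_of :: "'a matroid \<Rightarrow> 'a matroid \<Rightarrow> bool" where
  "is_minor_of N M \<longleftrightarrow>
     (\<exists>C D. C \<subseteq> ground M \<and> D \<subseteq> ground M \<and> C \<inter> D = {} \<and>
        N = delete_matroid (contract_matroid M C) D)"

definition matroid_isomorphic :: "'a matroid \<Rightarrow> 'b matroid \<Rightarrow> bool" where
  "matroid_isomorphic M N \<longleftrightarrow>
     (\<exists>f. bij_betw f (ground M) (ground N) \<and>
        (\<forall>I. I \<subseteq> ground M \<longrightarrow> (I \<in> indep M \<longleftrightarrow> f ` I \<in> indep N)))"

section \<open>Binary and regular matroids\<close>

text \<open>
  Representability over the two-element field \<^typ>\<open>bit\<close>: \<open>f\<close> sends each element of the
  ground set to a vector with coordinates \<open>0, \<dots>, d - 1\<close>, and independence in \<open>M\<close> is linear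
  independence of the corresponding family (so parallel elements may share a vector).
\<close>

definition binary_matroid :: "'a matroid \<Rightarrow> bool" where
  "binary_matroid M \<longleftrightarrow>
     is_matroid M \<and>
     (\<exists>(d::nat) (f :: 'a \<Rightarrow> nat \<Rightarrow> bit). \<forall>I. I \<subseteq> ground M \<longrightarrow>
        (I \<in> indep M \<longleftrightarrow>
         (\<forall>c :: 'a \<Rightarrow> bit. (\<forall>j<d. (\<Sum>e\<in>I. c e * f e j) = 0) \<longrightarrow> (\<forall>e\<in>I. c e = 0))))"

instance bit :: finite
proof
  have "UNIV = {0, 1::bit}" by auto
  then show "finite (UNIV :: bit set)" by (metis finite.emptyI finite_insert)
qed

definition linear_matroid :: "(bit ^ 'n::finite) set \<Rightarrow> (bit ^ 'n) matroid" where
  "linear_matroid S = \<lparr>ground = S, indep = {I. I \<subseteq> S \<and> vec.independent I}\<rparr>"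

lemma is_matroid_linear_matroid:
  fixes S :: "(bit ^ 'n::finite) set"
  shows "is_matroid (linear_matroid S)"
proof -
  have "\<exists>x\<in>J - I. insert x I \<subseteq> S \<and> vec.independent (insert x I)"
    if I: "I \<subseteq> S" "vec.independent I" and J: "J \<subseteq> S" "vec.independent J"
      and less: "card I < card J" for I J :: "(bit ^ 'n) set"
  proof (rule ccontr)
    assume "\<not> ?thesis"
    then have "\<forall>x\<in>J - I. x \<in> vec.span I"
      using I J by (auto simp: vec.independent_insert)
    then have "J \<subseteq> vec.span I"
      using vec.span_superset by blast
    then have "card J \<le> card I"
      using vec.independent_span_bound[of I J] J(2) vec.finiteI_independent[OF I(2)] by auto
    with less show False by simp
  qed
  moreover have "finite S" by simp
  ultimately show ?thesis
    unfolding is_matroid_def linear_matroid_def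
    using vec.independent_mono by (auto simp: vec.independent_empty)
qed

definition fano_matroid :: "(bit ^ 3) matroid" where
  "fano_matroid = linear_matroid (UNIV - {0})"

definition regular_matroid :: "'a matroid \<Rightarrow> bool" where
  "regular_matroid M \<longleftrightarrow>
     binary_matroid M \<and>
     \<not> (\<exists>N. is_minor_of N M \<and>
          (matroid_isomorphic N fano_matroid \<or> matroid_isomorphic N (dual_matroid fano_matroid)))"

text \<open>
  The underlying set of the poset \<open>IR(r, F\<^sub>2)\<close>, where \<open>r = CARD('n)\<close>; the order is the
  inclusion order \<open>(\<le>)\<close> on the type of sets.
\<close>

definition IR :: "(bit ^ 'n::finite) set set" where
  "IR = {S. S \<subseteq> UNIV - {0} \<and> regular_matroid (linear_matroid S) \<and>
            matroid_rank (linear_matroid S) = CARD('n)}"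

section \<open>Geometric realization of posets\<close>

definition order_complex :: "'a::order set \<Rightarrow> 'a set set" where
  "order_complex P =
     {\<sigma>. \<sigma> \<subseteq> P \<and> finite \<sigma> \<and> \<sigma> \<noteq> {} \<and> Complete_Partial_Order.chain (\<le>) \<sigma>}"

text \<open>The closed simplex with vertex set \<open>\<sigma>\<close>, in barycentric coordinates.\<close>

definition closed_simplex :: "'v set \<Rightarrow> ('v \<Rightarrow> real) set" where
  "closed_simplex \<sigma> = {t. (\<forall>v. 0 \<le> t v) \<and> (\<forall>v. v \<notin> \<sigma> \<longrightarrow> t v = 0) \<and> sum t \<sigma> = 1}"

text \<open>
  The realization of an abstract simplicial complex \<open>K\<close> (a family of finite nonempty simplices)
  with the weak topology: a set is open iff its trace on every closed simplex is open. On each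
  closed simplex, the topology of pointwise convergence is the Euclidean one.
\<close>

definition complex_realization :: "'v set set \<Rightarrow> ('v \<Rightarrow> real) topology" where
  "complex_realization K = topology (\<lambda>U. U \<subseteq> \<Union> (closed_simplex ` K) \<and>
     (\<forall>\<sigma>\<in>K. openin (top_of_set (closed_simplex \<sigma>)) (closed_simplex \<sigma> \<inter> U)))"

lemma openin_complex_realization:
  "openin (complex_realization K) U \<longleftrightarrow> U \<subseteq> \<Union> (closed_simplex ` K) \<and>
     (\<forall>\<sigma>\<in>K. openin (top_of_set (closed_simplex \<sigma>)) (closed_simplex \<sigma> \<inter> U))"
proof -
  have "istopology (\<lambda>U. U \<subseteq> \<Union> (closed_simplex ` K) \<and>
     (\<forall>\<sigma>\<in>K. openin (top_of_set (closed_simplex \<sigma>)) (closed_simplex \<sigma> \<inter> U)))"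
    unfolding istopology_def
  proof (intro conjI allI impI; (elim conjE)?)
    fix S T :: "('a \<Rightarrow> real) set"
    assume S: "\<forall>\<sigma>\<in>K. openin (top_of_set (closed_simplex \<sigma>)) (closed_simplex \<sigma> \<inter> S)"
      and T: "\<forall>\<sigma>\<in>K. openin (top_of_set (closed_simplex \<sigma>)) (closed_simplex \<sigma> \<inter> T)"
    show "\<forall>\<sigma>\<in>K. openin (top_of_set (closed_simplex \<sigma>)) (closed_simplex \<sigma> \<inter> (S \<inter> T))"
    proof
      fix \<sigma> assume "\<sigma> \<in> K"
      have "openin (top_of_set (closed_simplex \<sigma>))
          ((closed_simplex \<sigma> \<inter> S) \<inter> (closed_simplex \<sigma> \<inter> T))"
        by (rule openin_Int[OF bspec[OF S] bspec[OF T]]) fact+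
      also have "(closed_simplex \<sigma> \<inter> S) \<inter> (closed_simplex \<sigma> \<inter> T) = closed_simplex \<sigma> \<inter> (S \<inter> T)"
        by blast
      finally show "openin (top_of_set (closed_simplex \<sigma>)) (closed_simplex \<sigma> \<inter> (S \<inter> T))" .
    qed
  next
    fix \<K> :: "('a \<Rightarrow> real) set set"
    assume *: "\<forall>S\<in>\<K>. S \<subseteq> \<Union> (closed_simplex ` K) \<and>
      (\<forall>\<sigma>\<in>K. openin (top_of_set (closed_simplex \<sigma>)) (closed_simplex \<sigma> \<inter> S))"
    show "\<forall>\<sigma>\<in>K. openin (top_of_set (closed_simplex \<sigma>)) (closed_simplex \<sigma> \<inter> \<Union>\<K>)"
      unfolding Int_Union using * by (intro ballI openin_Union) auto
  qed auto
  then show ?thesis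
    by (simp add: complex_realization_def topology_inverse'[OF \<open>istopology _\<close>])
qed

definition poset_realization :: "'a::order set \<Rightarrow> ('a \<Rightarrow> real) topology" where
  "poset_realization P = complex_realization (order_complex P)"

section \<open>Wedge sums\<close>

definition quotient_topology :: "'a topology \<Rightarrow> ('a \<Rightarrow> 'b) \<Rightarrow> 'b topology" where
  "quotient_topology X q =
     topology (\<lambda>U. U \<subseteq> q ` topspace X \<and> openin X {x \<in> topspace X. q x \<in> U})"

lemma openin_quotient_topology:
  "openin (quotient_topology X q) U \<longleftrightarrow>
     U \<subseteq> q ` topspace X \<and> openin X {x \<in> topspace X. q x \<in> U}"
proof -
  have "istopology (\<lambda>U. U \<subseteq> q ` topspace X \<and> openin X {x \<in> topspace X. q x \<in> U})"
    unfolding istopology_def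
  proof (intro conjI allI impI; (elim conjE)?)
    fix S T
    assume "openin X {x \<in> topspace X. q x \<in> S}" "openin X {x \<in> topspace X. q x \<in> T}"
    moreover have "{x \<in> topspace X. q x \<in> S \<inter> T} =
        {x \<in> topspace X. q x \<in> S} \<inter> {x \<in> topspace X. q x \<in> T}"
      by blast
    ultimately show "openin X {x \<in> topspace X. q x \<in> S \<inter> T}"
      by (simp only: openin_Int)
  next
    fix \<K>
    assume *: "\<forall>S\<in>\<K>. S \<subseteq> q ` topspace X \<and> openin X {x \<in> topspace X. q x \<in> S}"
    have "{x \<in> topspace X. q x \<in> \<Union>\<K>} = (\<Union>S\<in>\<K>. {x \<in> topspace X. q x \<in> S})"
      by blast
    then show "openin X {x \<in> topspace X. q x \<in> \<Union>\<K>}"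
      using * by (simp only:) (intro openin_Union, blast)
  qed auto
  then show ?thesis
    by (simp add: quotient_topology_def topology_inverse'[OF \<open>istopology _\<close>])
qed

lemma topspace_quotient_topology: "topspace (quotient_topology X q) = q ` topspace X"
proof
  have "{x \<in> topspace X. q x \<in> q ` topspace X} = topspace X" by blast
  then have "openin (quotient_topology X q) (q ` topspace X)"
    by (simp add: openin_quotient_topology)
  then show "q ` topspace X \<subseteq> topspace (quotient_topology X q)"
    by (rule openin_subset)
next
  have "openin (quotient_topology X q) (topspace (quotient_topology X q))" by (rule openin_topspace)
  then show "topspace (quotient_topology X q) \<subseteq> q ` topspace X"
    unfolding openin_quotient_topology by (rule conjunct1)
qed

lemma quotient_map_quotient_topology: "quotient_map X (quotient_topology X q) q"
  by (simp add: quotient_map_def topspace_quotient_topology openin_quotient_topology)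

text \<open>
  The wedge of the pointed spaces \<open>(X i, p i)\<close> for \<open>i \<in> I\<close>: the quotient of the disjoint union
  identifying all base points, with \<^const>\<open>None\<close> as the common base point.
\<close>

definition wedge_topology ::
    "('i \<Rightarrow> 'a topology) \<Rightarrow> ('i \<Rightarrow> 'a) \<Rightarrow> 'i set \<Rightarrow> ('i \<times> 'a) option topology" where
  "wedge_topology X p I =
     quotient_topology (sum_topology X I) (\<lambda>(i, x). if x = p i then None else Some (i, x))"

definition nsphere_basepoint :: "nat \<Rightarrow> real" where
  "nsphere_basepoint = (\<lambda>i. if i = 0 then 1 else 0)"

definition wedge_of_spheres :: "nat \<Rightarrow> nat \<Rightarrow> (nat \<times> (nat \<Rightarrow> real)) option topology" where
  "wedge_of_spheres m n = wedge_topology (\<lambda>_. nsphere n) (\<lambda>_. nsphere_basepoint) {..<m}"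

end

(* Complementation in the seven points of the Fano plane turns IR(3, F_2) into the face poset of the
   simplicial complex of nonempty sets whose complement contains a basis, so the realization of the
   poset is the barycentric subdivision of this complex. The complex is pure of dimension 3 with 28
   facets. Twenty of them form an absolute retract A, since they can be glued one at a time along
   cones. The remaining eight are 3-simplices that meet A, and each other, only in their boundaries.
   By the homotopy extension property, collapsing A is a homotopy equivalence, and it turns each of
   these simplices into a 3-sphere. *)
theory Submission
  imports Defs
begin

section \<open>Collapsing an absolute retract\<close>

text \<open>The number eight agrees with the Euler characteristic. Of the 35 triples of points 7 are
  lines, which leaves 28 bases and so 28 facets. Any four points contain a basis, so all nonempty
  sets of at most three points are faces, and 7 - 21 + 35 - 28 = 1 - 8. A finite complex is an ANR,
  so being an absolute retract asks no more of it than contractibility. The stronger notion pays off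
  twice: gluing along an AR preserves it without any explicit homotopy, and the extension property
  of ANRs drives the collapse. The obstacle is that realizations carry a weak topology on a function
  space, whereas retracts are handled in Euclidean space. Finiteness removes it: every space
  involved is compact Hausdorff, so a continuous bijection is a homeomorphism and a continuous
  surjection a quotient map.\<close>

lemma homotopy_equivalent_space_collapse:
  fixes X A :: "'a::euclidean_space set" and W :: "'b topology"
  assumes X: "compact X" "ANR X" and A: "closed A" "AR A" "A \<subseteq> X"
    and W: "Hausdorff_space W" and f: "continuous_map (top_of_set X) W f" "f ` X = topspace W"
    and inj: "\<And>x y. x \<in> X \<Longrightarrow> y \<in> X \<Longrightarrow> f x = f y \<longleftrightarrow> x = y \<or> x \<in> A \<and> y \<in> A"
  shows "top_of_set X homotopy_equivalent_space W"
proof -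
  have "contractible A" using A(2) by (simp add: AR_ANR)
  then obtain a where "homotopic_with_canon (\<lambda>x. True) A A id (\<lambda>x. a)"
    unfolding contractible_def by blast
  then obtain H where H: "continuous_on ({0..1::real} \<times> A) H" "H ` ({0..1} \<times> A) \<subseteq> A"
    and H0: "\<And>x. x \<in> A \<Longrightarrow> H (0, x) = x" and H1: "\<And>x. x \<in> A \<Longrightarrow> H (1, x) = a"
    by (subst (asm) homotopic_with) (auto simp: prod_topology_subtopology_eu image_subset_iff_funcset[symmetric])
  \<comment> \<open>Extend the contraction of \<open>A\<close> to a homotopy of \<open>X\<close> that keeps \<open>A\<close> inside \<open>A\<close>, so that it descends to \<open>W\<close>.\<close>
  define Z where "Z = {0::real} \<times> X \<union> {0..1} \<times> A"
  define g where "g = (\<lambda>z::real \<times> 'a. if fst z = 0 then snd z else H z)"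
  have cX: "closed X" using X(1) compact_imp_closed by blast
  have "continuous_on Z g"
    unfolding Z_def g_def
  proof (rule continuous_on_cases)
    show "closed ({0::real} \<times> X)" "closed ({0..1::real} \<times> A)"
      using cX A by (simp_all add: closed_Times)
    show "continuous_on ({0::real} \<times> X) snd" by (intro continuous_intros)
    show "continuous_on ({0..1} \<times> A) H" by (rule H)
    show "\<forall>z. z \<in> {0} \<times> X \<and> fst z \<noteq> (0::real) \<or> z \<in> {0..1} \<times> A \<and> fst z = 0 \<longrightarrow> snd z = H z"
      using H0 by auto
  qed
  moreover have "g \<in> Z \<rightarrow> X"
    using H(2) A(3) by (auto simp: g_def Z_def image_subset_iff)
  moreover have "closedin (top_of_set ({0..1} \<times> X)) Z"
    unfolding Z_def using A cX by (intro closed_subset) (auto simp: closed_Times closed_Un)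
  ultimately obtain V G where V: "Z \<subseteq> V" "openin (top_of_set ({0..1} \<times> X)) V"
    and G: "continuous_on V G" "G \<in> V \<rightarrow> X" "\<And>x. x \<in> Z \<Longrightarrow> G x = g x"
    using ANR_imp_absolute_neighbourhood_extensor[OF X(2)] by metis
  \<comment> \<open>\<open>B\<close> collects the points of \<open>X\<close> whose time line is not
    wholly inside \<open>V\<close>. It is compact as a projection and misses \<open>A\<close>
    because \<open>Z\<close> lies in \<open>V\<close>. A Urysohn function, 1 on \<open>A\<close> and
    0 on \<open>B\<close>, slows time down so that \<open>(t * u x, x)\<close> never leaves
    \<open>V\<close>.\<close>
  define B where "B = snd ` ({0..1} \<times> X - V)"
  have "closedin (top_of_set ({0..1} \<times> X)) ({0..1} \<times> X - V)"
    using V(2) by (simp add: closedin_diff)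
  then have "compact ({0..1} \<times> X - V)"
    using closedin_compact[OF compact_Times[OF compact_Icc X(1)]] by blast
  then have "compact B" unfolding B_def by (intro compact_continuous_image continuous_intros)
  have "A \<inter> B = {}" using V(1) by (auto simp: B_def Z_def)
  obtain u :: "'a \<Rightarrow> real" where u: "continuous_on UNIV u" "\<And>x. u x \<in> closed_segment 1 0"
    "\<And>x. x \<in> A \<Longrightarrow> u x = 1" "\<And>x. x \<in> B \<Longrightarrow> u x = 0"
    using Urysohn[OF A(1) compact_imp_closed[OF \<open>compact B\<close>] \<open>A \<inter> B = {}\<close>] by metis
  have u01: "0 \<le> u x" "u x \<le> 1" for x
    using u(2)[of x] by (auto simp: closed_segment_eq_real_ivl split: if_splits)
  define h where "h = (\<lambda>(t::real, x). G (t * u x, x))"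
  have inV: "(t * u x, x) \<in> V" if "t \<in> {0..1}" "x \<in> X" for t x
  proof (cases "x \<in> B")
    case True
    then show ?thesis using u(4) that V(1) by (auto simp: Z_def)
  next
    case False
    have "t * u x \<in> {0..1}" using that u01[of x] by (auto simp: mult_le_one)
    then show ?thesis using False that by (force simp: B_def)
  qed
  have h: "continuous_on ({0..1} \<times> X) h"
    unfolding h_def split_def
    using inV by (intro continuous_on_compose2[OF G(1)] continuous_intros continuous_on_compose2[OF u(1)]) auto
  have hX: "h z \<in> X" if "z \<in> {0..1} \<times> X" for z
    using that inV G(2) by (auto simp: h_def)
  have h0: "h (0, x) = x" if "x \<in> X" for x
    using that G(3)[of "(0,x)"] by (simp add: h_def Z_def g_def)
  have hA: "h (t, x) = H (t, x)" if "x \<in> A" "t \<in> {0..1}" for t x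
    using that G(3)[of "(t,x)"] u(3) H0 by (auto simp: h_def Z_def g_def)
  have fh: "f (h (t, x)) = f (h (t, y))" if "x \<in> X" "y \<in> X" "f x = f y" "t \<in> {0..1}" for x y t
  proof (cases "x = y")
    case False
    then have "x \<in> A" "y \<in> A" using inj that by auto
    then have "h (t, x) \<in> A" "h (t, y) \<in> A" using hA that(4) H(2) by auto
    then show ?thesis using inj A(3) by blast
  qed simp
  have h1: "h (1, x) = h (1, y)" if "x \<in> X" "y \<in> X" "f x = f y" for x y
    using inj[of x y] that hA H1 by auto
  define p where "p = inv_into X f"
  have p: "p w \<in> X" "f (p w) = w" if "w \<in> topspace W" for w
    using that f(2) by (auto simp: p_def inv_into_into f_inv_into_f)
  have fX: "f x \<in> topspace W" if "x \<in> X" for x using f(2) that by blast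
  have qf: "quotient_map (top_of_set X) W f"
    by (rule T1_Spaces.continuous_imp_quotient_map) (use f W X in \<open>auto simp: compact_space_subtopology\<close>)
  \<comment> \<open>At time 1 all of \<open>A\<close> sits at \<open>a\<close>, so the map is
    constant on the fibres of \<open>f\<close> and factors through it. The choice of preimages
    \<open>p\<close> need not be continuous.\<close>
  define r where "r = (\<lambda>w. h (1, p w))"
  have rf: "r (f x) = h (1, x)" if "x \<in> X" for x
    unfolding r_def using h1[of "p (f x)" x] p fX that by simp
  let ?I = "top_of_set {0..1::real}"
  have contr: "continuous_map W (top_of_set X) r"
  proof (rule continuous_compose_quotient_map[OF qf])
    have "continuous_map (top_of_set X) (top_of_set X) (\<lambda>x. h (1, x))"
      using hX by (auto intro!: continuous_on_compose2[OF h] continuous_intros)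
    then show "continuous_map (top_of_set X) (top_of_set X) (r \<circ> f)"
      by (rule continuous_map_eq) (simp add: rf)
  qed
  have IX: "prod_topology ?I (top_of_set X) = top_of_set ({0..1} \<times> X)"
    by (simp add: prod_topology_subtopology_eu)
  have "homotopic_with (\<lambda>x. True) (top_of_set X) (top_of_set X) id (r \<circ> f)"
    by (subst homotopic_with) (auto intro!: exI[of _ h] simp: IX h hX h0 rf)
  then have 1: "homotopic_with (\<lambda>x. True) (top_of_set X) (top_of_set X) (r \<circ> f) id"
    by (rule homotopic_with_symD)
  define F where "F = (\<lambda>(t, w). f (h (t, p w)))"
  \<comment> \<open>Crossing with the interval keeps the quotient property because the product is
    again a continuous surjection from a compact onto a Hausdorff space. Continuity of the homotopy
    on \<open>W\<close> can thus be tested on \<open>X\<close>.\<close>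
  have "quotient_map (prod_topology ?I (top_of_set X)) (prod_topology ?I W) (\<lambda>(t, x). (t, f x))"
  proof (rule T1_Spaces.continuous_imp_quotient_map)
    show "continuous_map (prod_topology ?I (top_of_set X)) (prod_topology ?I W) (\<lambda>(t, x). (t, f x))"
      using f(1) unfolding split_def
      by (intro continuous_map_pairedI continuous_map_fst continuous_map_compose[OF continuous_map_snd, unfolded o_def])
    show "compact_space (prod_topology ?I (top_of_set X))"
      using compact_Times[OF compact_Icc X(1), of 0 1] by (simp add: IX compact_space_subtopology)
    show "Hausdorff_space (prod_topology ?I W)"
      using W by (simp add: Hausdorff_space_prod_topology Hausdorff_space_subtopology)
    show "(\<lambda>(t, x). (t, f x)) ` topspace (prod_topology ?I (top_of_set X)) = topspace (prod_topology ?I W)"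
      using f(2) by (force simp: image_iff)
  qed
  moreover have "continuous_map (prod_topology ?I (top_of_set X)) W (F \<circ> (\<lambda>(t, x). (t, f x)))"
  proof -
    have "continuous_map (prod_topology ?I (top_of_set X)) (top_of_set X) h"
      using h hX by (auto simp: IX)
    then have "continuous_map (prod_topology ?I (top_of_set X)) W (f \<circ> h)"
      using f(1) by (rule continuous_map_compose)
    moreover have "f (h (t, x)) = F (t, f x)" if "x \<in> X" "t \<in> {0..1}" for t x
      unfolding F_def using fh[of "p (f x)" x] p fX that by simp
    ultimately show ?thesis
      by (elim continuous_map_eq) auto
  qed
  ultimately have contF: "continuous_map (prod_topology ?I W) W F"
    by (rule continuous_compose_quotient_map)
  have "F (0, w) = w" "F (1, w) = f (r w)" if "w \<in> topspace W" for w
    using that by (simp_all add: F_def r_def h0 p)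
  then have "homotopic_with (\<lambda>x. True) W W id (f \<circ> r)"
    using contF by (subst homotopic_with) auto
  then have 2: "homotopic_with (\<lambda>x. True) W W (f \<circ> r) id"
    by (rule homotopic_with_symD)
  show ?thesis
    unfolding homotopy_equivalent_space_def using f(1) contr 1 2 by blast
qed

section \<open>Geometric simplicial complexes\<close>

text \<open>The simplex of \<open>closed_simplex\<close>, placed in a Euclidean space. Summing over
  all coordinates rather than over \<open>F\<close> makes intersections of simplices match
  intersections of vertex sets even in the disjoint case, since \<open>simplex_on {}\<close> is
  empty.\<close>

definition simplex_on :: "'v::finite set \<Rightarrow> (real ^ 'v) set" where
  "simplex_on F = {x. (\<forall>v. 0 \<le> x $ v) \<and> (\<forall>v. v \<notin> F \<longrightarrow> x $ v = 0) \<and> (\<Sum>v\<in>UNIV. x $ v) = 1}"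

lemma simplex_on_Int: "simplex_on (F \<inter> G) = simplex_on F \<inter> simplex_on G"
  by (auto simp: simplex_on_def)

lemma simplex_on_mono: "F \<subseteq> G \<Longrightarrow> simplex_on F \<subseteq> simplex_on G"
  by (auto simp: simplex_on_def)

lemma axis_in_simplex_on: "v \<in> F \<Longrightarrow> axis v 1 \<in> simplex_on F"
  by (auto simp: simplex_on_def axis_def)

lemma convex_simplex_on: "convex (simplex_on F)"
proof (rule convexI)
  fix x y :: "real ^ 'a" and u v :: real
  assume "x \<in> simplex_on F" "y \<in> simplex_on F" "0 \<le> u" "0 \<le> v" "u + v = 1"
  moreover have "(\<Sum>i\<in>UNIV. (u *\<^sub>R x + v *\<^sub>R y) $ i) = u * (\<Sum>i\<in>UNIV. x $ i) + v * (\<Sum>i\<in>UNIV. y $ i)"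
    by (simp add: sum.distrib sum_distrib_left)
  ultimately show "u *\<^sub>R x + v *\<^sub>R y \<in> simplex_on F"
    by (simp add: simplex_on_def)
qed

lemma compact_simplex_on: "compact (simplex_on F)"
proof -
  have "closed {x::real ^ 'a. \<forall>v. 0 \<le> x $ v}" "closed {x::real ^ 'a. \<forall>v. v \<notin> F \<longrightarrow> x $ v = 0}"
    "closed {x::real ^ 'a. (\<Sum>v\<in>UNIV. x $ v) = 1}"
    by (intro closed_Collect_all closed_Collect_le closed_Collect_imp closed_Collect_eq
        open_Collect_const continuous_intros)+
  then have "closed (simplex_on F)"
    unfolding simplex_on_def by (intro closed_Collect_conj)
  moreover have "simplex_on F \<subseteq> cbox 0 (\<chi> v. 1)"
  proof
    fix x assume x: "x \<in> simplex_on F"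
    have "x $ v \<le> 1" for v
      using member_le_sum[of v UNIV "($) x"] x by (auto simp: simplex_on_def)
    then show "x \<in> cbox 0 (\<chi> v. 1)" using x by (auto simp: simplex_on_def mem_box_cart)
  qed
  ultimately show ?thesis
    by (meson bounded_cbox bounded_subset compact_eq_bounded_closed)
qed

lemma closed_simplex_on: "closed (simplex_on F)"
  by (simp add: compact_imp_closed compact_simplex_on)

lemma ANR_Union_simplex_on: "ANR (\<Union>F\<in>K. simplex_on F)"
  by (rule ANR_finite_Union_convex_closed) (auto simp: closed_simplex_on convex_simplex_on)

text \<open>
  The list is read from its end: each set, glued to the union of those after it, meets them in a
  subcomplex that is a cone with apex \<open>v\<close>.
\<close>

fun cone_shelling :: "'v set list \<Rightarrow> bool" where
  "cone_shelling [] \<longleftrightarrow> False"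
| "cone_shelling [F] \<longleftrightarrow> F \<noteq> {}"
| "cone_shelling (F # Fs) \<longleftrightarrow> cone_shelling Fs \<and>
     (\<exists>v\<in>F. \<forall>G\<in>set Fs. \<exists>H\<in>set Fs. insert v (G \<inter> F) \<subseteq> H)"

text \<open>The part of a new simplex that is already covered is starlike about
  \<open>axis v 1\<close>, hence contractible; as a finite union of closed convex sets it is an ANR,
  and so an AR. Two closed ARs that meet in an AR have an AR as their union.\<close>

lemma AR_cone_shelling:
  fixes Fs :: "'v::finite set list"
  assumes "cone_shelling Fs"
  shows "AR (\<Union>F\<in>set Fs. simplex_on F)"
  using assms
proof (induction Fs rule: cone_shelling.induct)
  case (2 F)
  then obtain v where "v \<in> F" by auto
  then have "simplex_on F \<noteq> {}" using axis_in_simplex_on[of v F] by blast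
  then show ?case by (simp add: convex_imp_AR convex_simplex_on)
next
  case (3 F F' Fs')
  define Fs where "Fs = F' # Fs'"
  obtain v where v: "v \<in> F" and cone: "\<And>G. G \<in> set Fs \<Longrightarrow> \<exists>H\<in>set Fs. insert v (G \<inter> F) \<subseteq> H"
    using 3(2) by (auto simp: Fs_def)
  define U where "U = (\<Union>G\<in>set Fs. simplex_on G)"
  have int: "simplex_on F \<inter> U = (\<Union>G\<in>set Fs. simplex_on (G \<inter> F))"
    by (auto simp: U_def simplex_on_Int)
  obtain H where "H \<in> set Fs" "v \<in> H" using cone[of F'] by (auto simp: Fs_def)
  then have apex: "axis v 1 \<in> simplex_on F \<inter> U"
    using v axis_in_simplex_on[of v F] axis_in_simplex_on[of v H] by (auto simp: U_def)
  moreover have "closed_segment (axis v 1) x \<subseteq> simplex_on F \<inter> U" if "x \<in> simplex_on F \<inter> U" for x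
  proof -
    from that obtain G where G: "G \<in> set Fs" "x \<in> simplex_on (G \<inter> F)" by (auto simp: int)
    then obtain H where H: "H \<in> set Fs" "insert v (G \<inter> F) \<subseteq> H" using cone by blast
    then have "x \<in> simplex_on (H \<inter> F)" "axis v 1 \<in> simplex_on (H \<inter> F)"
      using G(2) v simplex_on_mono[of "G \<inter> F" "H \<inter> F"] axis_in_simplex_on[of v "H \<inter> F"] by auto
    then have "closed_segment (axis v 1) x \<subseteq> simplex_on (H \<inter> F)"
      by (simp add: closed_segment_subset convex_simplex_on)
    then show ?thesis using H(1) by (auto simp: int)
  qed
  ultimately have "starlike (simplex_on F \<inter> U)"
    unfolding starlike_def by (intro bexI[of _ "axis v 1"] ballI)
  then have "contractible (simplex_on F \<inter> U)"
    by (rule starlike_imp_contractible)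
  moreover have "simplex_on F \<inter> U \<noteq> {}" using apex by blast
  moreover have "ANR (simplex_on F \<inter> U)"
    using ANR_Union_simplex_on[of "(\<lambda>G. G \<inter> F) ` set Fs"] by (simp add: int)
  ultimately have "AR (simplex_on F \<inter> U)" by (simp add: AR_ANR)
  moreover have "AR U" using 3 by (simp add: U_def Fs_def)
  moreover have "AR (simplex_on F)"
    using apex by (intro convex_imp_AR convex_simplex_on) blast
  moreover have "closed U" unfolding U_def by (intro closed_UN) (simp_all add: closed_simplex_on)
  ultimately have "AR (simplex_on F \<union> U)"
    by (intro AR_closed_Un_local) (auto intro!: closed_subset closed_simplex_on)
  then show ?case by (simp add: U_def Fs_def)
qed simp

text \<open>Carries a shelling checked on numbers over to vectors. Injectivity makes images commute
  with the intersections in the cone condition.\<close>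

lemma cone_shelling_map_image:
  assumes "cone_shelling Fs" "inj_on f (\<Union>(set Fs))"
  shows "cone_shelling (map ((`) f) Fs)"
  using assms
proof (induction Fs rule: cone_shelling.induct)
  case (3 F F' Fs')
  define Fs where "Fs = F' # Fs'"
  obtain v where v: "v \<in> F" and cone: "\<And>G. G \<in> set Fs \<Longrightarrow> \<exists>H\<in>set Fs. insert v (G \<inter> F) \<subseteq> H"
    using 3(2) by (auto simp: Fs_def)
  have "\<exists>H\<in>set Fs. insert (f v) (f ` G \<inter> f ` F) \<subseteq> f ` H" if "G \<in> set Fs" for G
  proof -
    have "f ` G \<inter> f ` F = f ` (G \<inter> F)"
      using 3(3) that by (intro inj_on_image_Int[symmetric, OF 3(3)]) (auto simp: Fs_def)
    then show ?thesis using cone[OF that] by (metis image_insert image_mono)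
  qed
  moreover have "cone_shelling (map ((`) f) Fs)"
    using 3 inj_on_subset[OF 3(3), of "\<Union>(set Fs)"] by (simp add: Fs_def)
  ultimately have "cone_shelling (f ` F # map ((`) f) Fs)"
    using v unfolding Fs_def list.map cone_shelling.simps(3) by (intro conjI bexI[of _ "f v"]) auto
  then show ?case by (simp add: Fs_def)
qed auto

section \<open>Collapsing the boundary of a simplex\<close>

text \<open>
  The map \<open>x \<mapsto> (x i - x 0) / m\<close> with \<open>m\<close> the least coordinate sends the open simplex
  onto \<open>n\<close>-space; \<open>simplex_to_sphere\<close> follows it by inverse stereographic projection, with
  denominators cleared so that the formula also covers the boundary \<open>m = 0\<close>.
\<close>

definition simplex_to_sphere :: "nat \<Rightarrow> (nat \<Rightarrow> real) \<Rightarrow> nat \<Rightarrow> real" where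
  "simplex_to_sphere n x =
     (let m = Min (x ` {..n}); N = (\<Sum>i\<in>{..n} - {0}. (x i - x 0)\<^sup>2) in
      (\<lambda>i. if i = 0 then (N - m\<^sup>2) / (N + m\<^sup>2)
           else if i \<le> n then 2 * m * (x i - x 0) / (N + m\<^sup>2) else 0))"

lemma simplex_to_sphere_apply:
  assumes "m = Min (x ` {..n})" "N = (\<Sum>i\<in>{..n} - {0}. (x i - x 0)\<^sup>2)"
  shows "simplex_to_sphere n x i = (if i = 0 then (N - m\<^sup>2) / (N + m\<^sup>2)
           else if i \<le> n then 2 * m * (x i - x 0) / (N + m\<^sup>2) else 0)"
  by (simp add: simplex_to_sphere_def Let_def assms)

lemma simplex_to_sphere_cong:
  assumes "\<And>k. k \<le> n \<Longrightarrow> x k = y k"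
  shows "simplex_to_sphere n x = simplex_to_sphere n y"
proof -
  have "x ` {..n} = y ` {..n}" using assms by (intro image_cong) auto
  moreover have "(\<Sum>i\<in>{..n} - {0}. (x i - x 0)\<^sup>2) = (\<Sum>i\<in>{..n} - {0}. (y i - y 0)\<^sup>2)"
    using assms by (intro sum.cong) auto
  ultimately show ?thesis using assms by (simp add: simplex_to_sphere_def Let_def fun_eq_iff)
qed

definition std_simplex :: "nat \<Rightarrow> (nat \<Rightarrow> real) set" where
  "std_simplex n = {x. (\<forall>i\<le>n. 0 \<le> x i) \<and> (\<Sum>i\<le>n. x i) = 1}"

lemma sum_atMost_head: "(\<Sum>i\<le>n. f i) = f 0 + (\<Sum>i\<in>{..n} - {0}. f i)" for f :: "nat \<Rightarrow> 'a::comm_monoid_add"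
  by (simp add: sum.remove)

lemma Min_affine_image:
  fixes z :: "nat \<Rightarrow> real"
  assumes "0 \<le> m"
  shows "Min ((\<lambda>i. c + m * z i) ` {..n}) = c + m * Min (z ` {..n})"
proof -
  have "mono (\<lambda>t. c + m * t)" using assms by (intro monoI) (simp add: mult_left_mono)
  from mono_Min_commute[OF this, of "z ` {..n}"] show ?thesis by (simp add: image_image)
qed

lemma Min_std_simplex_nonneg: "x \<in> std_simplex n \<Longrightarrow> 0 \<le> Min (x ` {..n})"
  by (auto simp: std_simplex_def)

text \<open>Both terms vanish only if all coordinates agree and the least is 0, against the
  coordinate sum 1.\<close>

lemma simplex_to_sphere_denominator_pos:
  assumes "x \<in> std_simplex n"
  shows "0 < (\<Sum>i\<in>{..n} - {0}. (x i - x 0)\<^sup>2) + (Min (x ` {..n}))\<^sup>2"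
proof (rule ccontr)
  assume not: "\<not> ?thesis"
  have nonneg: "0 \<le> (\<Sum>i\<in>{..n} - {0}. (x i - x 0)\<^sup>2)" by (simp add: sum_nonneg)
  have m: "Min (x ` {..n}) = 0"
    using not nonneg zero_le_power2[of "Min (x ` {..n})"] by (smt (verit) zero_less_power2)
  then have "(\<Sum>i\<in>{..n} - {0}. (x i - x 0)\<^sup>2) = 0" using not nonneg by simp
  then have eq: "x i = x 0" if "i \<le> n" for i
    using that by (cases "i = 0") (auto simp: sum_nonneg_eq_0_iff)
  have "Min (x ` {..n}) \<in> x ` {..n}" by (rule Min_in) auto
  then obtain k where "k \<le> n" "x k = 0" using m by auto
  then have "x i = 0" if "i \<le> n" for i using eq that by metis
  then show False using assms by (simp add: std_simplex_def)
qed

lemma simplex_to_sphere_in_nsphere: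
  assumes "x \<in> std_simplex n"
  shows "simplex_to_sphere n x \<in> topspace (nsphere n)"
proof -
  define m N where "m = Min (x ` {..n})" and "N = (\<Sum>i\<in>{..n} - {0}. (x i - x 0)\<^sup>2)"
  have pos: "0 < N + m\<^sup>2" using simplex_to_sphere_denominator_pos[OF assms] by (simp add: N_def m_def)
  have "(\<Sum>i\<le>n. (simplex_to_sphere n x i)\<^sup>2) =
      ((N - m\<^sup>2) / (N + m\<^sup>2))\<^sup>2 + (\<Sum>i\<in>{..n} - {0}. (2 * m * (x i - x 0) / (N + m\<^sup>2))\<^sup>2)"
    unfolding sum_atMost_head by (simp add: simplex_to_sphere_apply[OF m_def N_def])
  also have "(\<Sum>i\<in>{..n} - {0}. (2 * m * (x i - x 0) / (N + m\<^sup>2))\<^sup>2) = (2 * m / (N + m\<^sup>2))\<^sup>2 * N"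
    unfolding N_def sum_distrib_left by (intro sum.cong) (auto simp: power_mult_distrib power_divide)
  also have "((N - m\<^sup>2) / (N + m\<^sup>2))\<^sup>2 + (2 * m / (N + m\<^sup>2))\<^sup>2 * N = 1"
    using pos by (simp add: power_divide divide_simps) (simp add: power2_eq_square algebra_simps)
  finally show ?thesis by (simp add: nsphere simplex_to_sphere_apply[OF m_def N_def])
qed

text \<open>The coordinate \<open>(N - m\<^sup>2) / (N + m\<^sup>2)\<close> is 1 exactly when
  \<open>m = 0\<close>, so the pole of the stereographic projection receives the whole boundary and
  nothing else.\<close>

lemma simplex_to_sphere_eq_basepoint_iff:
  assumes "x \<in> std_simplex n"
  shows "simplex_to_sphere n x = nsphere_basepoint \<longleftrightarrow> (\<exists>i\<le>n. x i = 0)"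
proof -
  define m N where "m = Min (x ` {..n})" and "N = (\<Sum>i\<in>{..n} - {0}. (x i - x 0)\<^sup>2)"
  have pos: "0 < N + m\<^sup>2" using simplex_to_sphere_denominator_pos[OF assms] by (simp add: N_def m_def)
  have "m = 0 \<longleftrightarrow> (\<exists>i\<le>n. x i = 0)"
  proof
    assume "m = 0"
    moreover have "m \<in> x ` {..n}" unfolding m_def by (rule Min_in) auto
    ultimately show "\<exists>i\<le>n. x i = 0" by auto
  next
    assume "\<exists>i\<le>n. x i = 0"
    then have "m \<le> 0" unfolding m_def by (metis Min_le atMost_iff finite_atMost finite_imageI imageI)
    then show "m = 0" using Min_std_simplex_nonneg[OF assms] by (simp add: m_def)
  qed
  moreover have "simplex_to_sphere n x = nsphere_basepoint" if "m = 0"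
  proof -
    have "N \<noteq> 0" using that pos by simp
    then show ?thesis
      using that by (simp add: fun_eq_iff simplex_to_sphere_apply[OF m_def N_def] nsphere_basepoint_def)
  qed
  moreover have "m = 0" if "simplex_to_sphere n x = nsphere_basepoint"
  proof -
    show ?thesis
      using fun_cong[OF that, of 0] pos
      by (simp add: simplex_to_sphere_apply[OF m_def N_def] nsphere_basepoint_def)
  qed
  ultimately show ?thesis by blast
qed

lemma simplex_to_sphere_inj:
  assumes x: "x \<in> std_simplex n" "\<forall>i\<le>n. x i \<noteq> 0" and y: "y \<in> std_simplex n" "\<forall>i\<le>n. y i \<noteq> 0"
    and eq: "simplex_to_sphere n x = simplex_to_sphere n y" and "i \<le> n"
  shows "x i = y i"
proof -
  \<comment> \<open>Stereographic projection from the base point, which returns the values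
    \<open>(w i - w 0) / m\<close>.\<close>
  define z where "z = (\<lambda>i. if i = 0 then 0 else simplex_to_sphere n x i / (1 - simplex_to_sphere n x 0))"
  define \<mu> where "\<mu> = Min (z ` {..n})"
  \<comment> \<open>The least of these values is \<open>\<mu> = 1 - w 0 / m\<close>, so
    \<open>w i = m * (1 - \<mu> + z i)\<close>, and the coordinate sum 1 determines
    \<open>m\<close>. The right-hand side depends only on the image point.\<close>
  have recover: "w i = (1 - \<mu> + z i) / (\<Sum>j\<le>n. 1 - \<mu> + z j)"
    if w: "w \<in> std_simplex n" "\<forall>i\<le>n. w i \<noteq> 0" and ws: "simplex_to_sphere n w = simplex_to_sphere n x"
      and "i \<le> n" for w i
  proof -
    define m N where "m = Min (w ` {..n})" and "N = (\<Sum>i\<in>{..n} - {0}. (w i - w 0)\<^sup>2)"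
    have pos: "0 < N + m\<^sup>2" using simplex_to_sphere_denominator_pos[OF w(1)] by (simp add: N_def m_def)
    have "m \<in> w ` {..n}" unfolding m_def by (rule Min_in) auto
    then have "m \<noteq> 0" using w(2) by auto
    have "1 - simplex_to_sphere n w 0 = 2 * m\<^sup>2 / (N + m\<^sup>2)"
      using pos by (simp add: simplex_to_sphere_apply[OF m_def N_def] divide_simps)
    then have "z i = simplex_to_sphere n w i / (2 * m\<^sup>2 / (N + m\<^sup>2))" if "i \<noteq> 0" for i
      using that by (simp add: z_def ws)
    then have "z i = (w i - w 0) / m" if "i \<le> n" for i
      using that pos \<open>m \<noteq> 0\<close>
      by (cases "i = 0") (simp_all add: z_def simplex_to_sphere_apply[OF m_def N_def] power2_eq_square)
    then have wz: "w i = w 0 + m * z i" if "i \<le> n" for i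
      using that \<open>m \<noteq> 0\<close> by (auto simp: field_simps)
    have "w ` {..n} = (\<lambda>i. w 0 + m * z i) ` {..n}" by (rule image_cong) (auto intro: wz)
    then have "m = w 0 + m * \<mu>"
      using Min_affine_image[of m "w 0" z n] Min_std_simplex_nonneg[OF w(1)] by (simp add: m_def \<mu>_def)
    then have wm: "w i = m * (1 - \<mu> + z i)" if "i \<le> n" for i
      using wz[OF that] by (simp add: algebra_simps)
    have "1 = (\<Sum>i\<le>n. w i)" using w(1) by (simp add: std_simplex_def)
    also have "\<dots> = m * (\<Sum>j\<le>n. 1 - \<mu> + z j)"
      using wm by (simp add: sum_distrib_left)
    finally have "m = 1 / (\<Sum>j\<le>n. 1 - \<mu> + z j)"
      by (metis mult_eq_0_iff nonzero_eq_divide_eq zero_neq_one)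
    then show ?thesis using wm[OF \<open>i \<le> n\<close>] by simp
  qed
  show ?thesis using recover[OF x refl \<open>i \<le> n\<close>] recover[OF y eq[symmetric] \<open>i \<le> n\<close>] by simp
qed

text \<open>The preimage is dictated by the formula behind injectivity. Each summand of
  \<open>D\<close> is at least 1, so \<open>m = 1 / D\<close> is positive, and it turns out to be
  the least coordinate of \<open>x\<close>.\<close>

lemma simplex_to_sphere_surj:
  assumes s: "s \<in> topspace (nsphere n)" "s \<noteq> nsphere_basepoint"
  obtains x where "x \<in> std_simplex n" "simplex_to_sphere n x = s"
proof -
  have s1: "(s 0)\<^sup>2 + (\<Sum>i\<in>{..n} - {0}. (s i)\<^sup>2) = 1" and s2: "\<And>i. n < i \<Longrightarrow> s i = 0"
    using s(1) sum_atMost_head[of "\<lambda>i. (s i)\<^sup>2" n] by (auto simp: nsphere)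
  have nn: "0 \<le> (\<Sum>i\<in>{..n} - {0}. (s i)\<^sup>2)" by (simp add: sum_nonneg)
  have "s 0 \<noteq> 1"
  proof
    assume "s 0 = 1"
    then have "(\<Sum>i\<in>{..n} - {0}. (s i)\<^sup>2) = 0" using s1 by simp
    then have "s i = 0" if "i \<noteq> 0" for i
      using that s2 by (cases "i \<le> n") (auto simp: sum_nonneg_eq_0_iff)
    then show False using s(2) \<open>s 0 = 1\<close> by (auto simp: nsphere_basepoint_def)
  qed
  moreover have "(s 0)\<^sup>2 \<le> 1" using s1 nn by simp
  ultimately have lt: "s 0 < 1" by (simp add: abs_square_le_1 abs_le_iff)
  define z where "z = (\<lambda>i. if i = 0 then 0 else s i / (1 - s 0))"
  define \<mu> where "\<mu> = Min (z ` {..n})"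
  have \<mu>: "\<mu> \<le> z i" if "i \<le> n" for i using that by (auto simp: \<mu>_def)
  define D where "D = (\<Sum>j\<le>n. 1 - \<mu> + z j)"
  have "(\<Sum>j\<le>n. 1) \<le> D" unfolding D_def using \<mu> by (intro sum_mono) auto
  then have "0 < D" by simp
  define m where "m = 1 / D"
  have "0 < m" using \<open>0 < D\<close> by (simp add: m_def)
  define x where "x = (\<lambda>i. m * (1 - \<mu>) + m * z i)"
  have "x \<in> std_simplex n"
    unfolding std_simplex_def
  proof (intro CollectI conjI allI impI)
    fix i assume "i \<le> n"
    have "x i = m * (1 - \<mu> + z i)" by (simp add: x_def algebra_simps)
    then show "0 \<le> x i" using \<mu>[OF \<open>i \<le> n\<close>] \<open>0 < m\<close> by simp
  next
    have "(\<Sum>i\<le>n. x i) = m * D" by (simp add: x_def D_def sum_distrib_left algebra_simps)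
    then show "(\<Sum>i\<le>n. x i) = 1" using \<open>0 < D\<close> by (simp add: m_def)
  qed
  moreover have "simplex_to_sphere n x = s"
  proof -
    have m: "Min (x ` {..n}) = m"
      using Min_affine_image[of m "m * (1 - \<mu>)" z n] \<open>0 < m\<close> by (simp add: x_def \<mu>_def algebra_simps)
    have dx: "x i - x 0 = m * z i" for i by (simp add: x_def z_def)
    have "(\<Sum>i\<in>{..n} - {0}. (x i - x 0)\<^sup>2) = (m / (1 - s 0))\<^sup>2 * (\<Sum>i\<in>{..n} - {0}. (s i)\<^sup>2)"
      unfolding dx sum_distrib_left by (intro sum.cong) (auto simp: z_def power_mult_distrib power_divide)
    also have "(\<Sum>i\<in>{..n} - {0}. (s i)\<^sup>2) = (1 - s 0) * (1 + s 0)"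
      using s1 by (simp add: power2_eq_square algebra_simps)
    also have "(m / (1 - s 0))\<^sup>2 * ((1 - s 0) * (1 + s 0)) = m\<^sup>2 * (1 + s 0) / (1 - s 0)"
      using lt by (simp add: power2_eq_square)
    finally have N: "(\<Sum>i\<in>{..n} - {0}. (x i - x 0)\<^sup>2) = m\<^sup>2 * (1 + s 0) / (1 - s 0)" .
    have D: "m\<^sup>2 * (1 + s 0) / (1 - s 0) + m\<^sup>2 = 2 * m\<^sup>2 / (1 - s 0)"
      and D': "m\<^sup>2 * (1 + s 0) / (1 - s 0) - m\<^sup>2 = s 0 * (2 * m\<^sup>2 / (1 - s 0))"
      using lt by (simp_all add: field_simps)
    show ?thesis
    proof
      fix i
      show "simplex_to_sphere n x i = s i"
        unfolding simplex_to_sphere_apply[OF m[symmetric] N[symmetric]] D D' dx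
        using lt \<open>0 < m\<close> s2[of i] by (cases "i = 0") (auto simp: z_def power2_eq_square)
    qed
  qed
  ultimately show ?thesis by (rule that)
qed

lemma continuous_on_Min_atMost:
  fixes g :: "'a::topological_space \<Rightarrow> nat \<Rightarrow> 'b::linorder_topology"
  assumes "\<And>i. i \<le> n \<Longrightarrow> continuous_on S (\<lambda>x. g x i)"
  shows "continuous_on S (\<lambda>x. Min (g x ` {..n}))"
  using assms
proof (induction n)
  case (Suc n)
  have "Min (g x ` {..Suc n}) = min (g x (Suc n)) (Min (g x ` {..n}))" for x
    by (simp add: atMost_Suc)
  then show ?case using Suc by (simp add: continuous_on_min)
qed simp

lemma continuous_on_simplex_to_sphere:
  fixes g :: "'a::topological_space \<Rightarrow> nat \<Rightarrow> real"
  assumes g: "\<And>i. i \<le> n \<Longrightarrow> continuous_on S (\<lambda>x. g x i)" and std: "\<And>x. x \<in> S \<Longrightarrow> g x \<in> std_simplex n"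
  shows "continuous_on S (\<lambda>x. simplex_to_sphere n (g x))"
proof (rule continuous_on_coordinatewise_then_product)
  fix i
  have "(\<Sum>i\<in>{..n} - {0}. (g x i - g x 0)\<^sup>2) + (Min (g x ` {..n}))\<^sup>2 \<noteq> 0" if "x \<in> S" for x
    using simplex_to_sphere_denominator_pos[OF std[OF that]] by simp
  then show "continuous_on S (\<lambda>x. simplex_to_sphere n (g x) i)"
    unfolding simplex_to_sphere_def Let_def
    by (cases "i = 0"; cases "i \<le> n")
      (auto intro!: continuous_intros continuous_on_Min_atMost g)
qed

section \<open>Wedges of spheres\<close>

definition wedge_inclusion :: "'i \<Rightarrow> 'a \<Rightarrow> 'a \<Rightarrow> ('i \<times> 'a) option" where
  "wedge_inclusion i b x = (if x = b then None else Some (i, x))"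

lemma continuous_map_wedge_inclusion:
  assumes "i \<in> I"
  shows "continuous_map (X i) (wedge_topology X p I) (wedge_inclusion i (p i))"
proof -
  have "wedge_inclusion i (p i) = (\<lambda>(i, x). if x = p i then None else Some (i, x)) \<circ> (\<lambda>x. (i, x))"
    by (auto simp: wedge_inclusion_def)
  then show ?thesis
    unfolding wedge_topology_def
    by (simp only:) (rule continuous_map_compose[OF continuous_map_component_injection[OF assms]
        quotient_imp_continuous_map[OF quotient_map_quotient_topology]])
qed

lemma topspace_wedge_topology:
  "topspace (wedge_topology X p I) = (\<Union>i\<in>I. wedge_inclusion i (p i) ` topspace (X i))"
proof -
  have "topspace (wedge_topology X p I) =
      (\<lambda>(i, x). wedge_inclusion i (p i) x) ` (SIGMA i:I. topspace (X i))"
    unfolding wedge_topology_def topspace_quotient_topology wedge_inclusion_def by (simp add: o_def)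
  also have "\<dots> = (\<Union>i\<in>I. wedge_inclusion i (p i) ` topspace (X i))"
    by auto
  finally show ?thesis .
qed

text \<open>The map \<open>e\<close> moves every base point to the origin and puts sphere
  \<open>i\<close> into the \<open>i\<close>-th block of coordinates. It is a continuous injection
  into a Hausdorff space.\<close>

lemma Hausdorff_space_wedge_of_spheres: "Hausdorff_space (wedge_of_spheres m n)"
proof -
  let ?b = nsphere_basepoint
  define e :: "(nat \<times> (nat \<Rightarrow> real)) option \<Rightarrow> nat \<Rightarrow> nat \<Rightarrow> real" where
    "e w = (case w of None \<Rightarrow> \<lambda>j k. 0 | Some (i, x) \<Rightarrow> \<lambda>j k. if j = i then x k - ?b k else 0)" for w
  let ?q = "\<lambda>(i::nat, x). if x = ?b then None else Some (i, x)"
  have eq: "(e \<circ> ?q) (i, x) = (\<lambda>j k. if j = i then x k - ?b k else 0)" for i x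
    by (auto simp: e_def fun_eq_iff)
  have "continuous_map (nsphere n) euclidean (\<lambda>x. (e \<circ> ?q) (i, x))" for i
  proof -
    have "continuous_on UNIV (\<lambda>(x::nat \<Rightarrow> real) j k. if j = i then x k - ?b k else 0)"
    proof (intro continuous_on_coordinatewise_then_product)
      fix j k
      show "continuous_on UNIV (\<lambda>x::nat \<Rightarrow> real. if j = i then x k - ?b k else 0)"
        by (cases "j = i") (auto intro!: continuous_intros)
    qed
    then show ?thesis
      unfolding eq nsphere euclidean_product_topology
      by simp (erule continuous_on_subset, simp)
  qed
  then have "continuous_map (sum_topology (\<lambda>_. nsphere n) {..<m}) euclidean (e \<circ> ?q)"
    unfolding continuous_map_def openin_sum_topology by auto
  then have "continuous_map (wedge_of_spheres m n) euclidean e"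
    unfolding wedge_of_spheres_def wedge_topology_def
    by (rule continuous_compose_quotient_map[OF quotient_map_quotient_topology])
  moreover have "inj_on e (topspace (wedge_of_spheres m n))"
  proof (rule inj_onI)
    fix v w assume "v \<in> topspace (wedge_of_spheres m n)" "w \<in> topspace (wedge_of_spheres m n)" "e v = e w"
    moreover have "e (Some (i, x)) = e w \<Longrightarrow> x \<noteq> ?b \<Longrightarrow> w = Some (i, x)" for i x w
    proof -
      assume eq: "e (Some (i, x)) = e w" and "x \<noteq> ?b"
      then obtain k where k: "x k \<noteq> ?b k" by auto
      then have "e w i k \<noteq> 0" unfolding eq[symmetric] by (simp add: e_def)
      then obtain y where w: "w = Some (i, y)"
        by (auto simp: e_def split: option.splits if_splits)
      have "x k = y k" for k
        using fun_cong[OF fun_cong[OF eq, of i], of k] by (simp add: e_def w)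
      then show "w = Some (i, x)" by (auto simp: w)
    qed
    moreover have "u = None \<or> (\<exists>i x. u = Some (i, x) \<and> x \<noteq> ?b)" if "u \<in> topspace (wedge_of_spheres m n)" for u
      using that by (auto simp: wedge_of_spheres_def topspace_wedge_topology wedge_inclusion_def split: if_splits)
    ultimately show "v = w" by metis
  qed
  ultimately show ?thesis
    by (rule Hausdorff_space_injective_preimage[OF Hausdorff_space_euclidean])
qed

section \<open>A complex with a shelling\<close>

text \<open>The collapsing map crushes the union \<open>A\<close> of the simplices in
  \<open>Ls\<close> and wraps each simplex of \<open>Ms\<close> around its own sphere. By
  \<open>bd\<close> the boundary of such a simplex lies in \<open>A\<close>; by \<open>new\<close>,
  distinctness and equal size its interior meets neither \<open>A\<close> nor another
  simplex.\<close>

lemma homotopy_equivalent_wedge_of_spheres: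
  fixes Ls Ms :: "'v::finite list list"
  assumes shell: "cone_shelling (map set Ls)"
    and Ms: "Ms \<noteq> []" "distinct (map set Ms)" "\<And>F. F \<in> set Ms \<Longrightarrow> distinct F \<and> length F = Suc n"
    and bd: "\<And>F v. F \<in> set Ms \<Longrightarrow> v \<in> set F \<Longrightarrow> \<exists>G\<in>set Ls. set F - {v} \<subseteq> set G"
    and new: "\<And>F G. F \<in> set Ms \<Longrightarrow> G \<in> set Ls \<Longrightarrow> \<not> set F \<subseteq> set G"
  shows "top_of_set (\<Union>F\<in>set (Ls @ Ms). simplex_on (set F)) homotopy_equivalent_space
           wedge_of_spheres (length Ms) n"
proof -
  define X where "X = (\<Union>F\<in>set (Ls @ Ms). simplex_on (set F))"
  define A where "A = (\<Union>F\<in>set Ls. simplex_on (set F))"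
  define I where "I = {..<length Ms}"
  define a where "a i k = Ms ! i ! k" for i k
  define F where "F i = set (Ms ! i)" for i
  let ?W = "wedge_of_spheres (length Ms) n"
  let ?b = nsphere_basepoint
  have Fi: "F i = a i ` {..n}" "inj_on (a i) {..n}" if "i \<in> I" for i
  proof -
    have "Ms ! i \<in> set Ms" using that by (simp add: I_def)
    then have *: "distinct (Ms ! i)" "length (Ms ! i) = Suc n" using Ms(3) by auto
    have "{..n} = {..<Suc n}" by auto
    then show "F i = a i ` {..n}" using *(2) by (auto simp: F_def a_def set_conv_nth)
    show "inj_on (a i) {..n}"
      using * by (auto simp: a_def inj_on_def nth_eq_iff_index_eq)
  qed
  have cardF: "card (F i) = Suc n" if "i \<in> I" for i
    using Fi[OF that] by (simp add: card_image)
  have Finj: "i = j" if "i \<in> I" "j \<in> I" "F i \<subseteq> F j" for i j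
  proof -
    have "F i = F j" using that cardF by (intro card_subset_eq) (auto simp: F_def)
    then show ?thesis using that Ms(2) by (simp add: F_def I_def distinct_conv_nth) metis
  qed
  have FA: "\<not> F i \<subseteq> set G" if "i \<in> I" "G \<in> set Ls" for i G
    using that new by (simp add: F_def I_def)
  have X: "X = A \<union> (\<Union>i\<in>I. simplex_on (F i))"
  proof -
    have "set Ms = (!) Ms ` I" by (auto simp: I_def in_set_conv_nth)
    then show ?thesis by (simp add: X_def A_def F_def)
  qed
  have FX: "simplex_on (F i) \<subseteq> X" if "i \<in> I" for i using that X by blast
  define s where "s i x = simplex_to_sphere n (\<lambda>k. x $ a i k)" for i and x :: "real ^ 'v"
  have std: "(\<lambda>k. x $ a i k) \<in> std_simplex n" if "i \<in> I" "x \<in> simplex_on (F i)" for i x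
  proof -
    have "(\<Sum>k\<le>n. x $ a i k) = (\<Sum>v\<in>F i. x $ v)"
      using Fi[OF that(1)] by (simp add: sum.reindex)
    also have "\<dots> = (\<Sum>v\<in>UNIV. x $ v)"
      using that(2) by (intro sum.mono_neutral_left) (auto simp: simplex_on_def)
    finally show ?thesis using that(2) by (simp add: std_simplex_def simplex_on_def)
  qed
  have sb: "s i x = ?b \<longleftrightarrow> (\<exists>v\<in>F i. x $ v = 0)" if "i \<in> I" "x \<in> simplex_on (F i)" for i x
    unfolding s_def simplex_to_sphere_eq_basepoint_iff[OF std[OF that]] using Fi(1)[OF that(1)] by auto
  define full where "full i x \<longleftrightarrow> i \<in> I \<and> (\<forall>v\<in>F i. x $ v \<noteq> 0)" for i and x :: "real ^ 'v"
  \<comment> \<open>The default \<open>None\<close> serves \<open>A\<close> and all the boundaries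
    at once. On the simplices the description is unambiguous: if no coordinate on \<open>F j\<close>
    vanishes at a point of \<open>simplex_on (F i)\<close>, then \<open>F j \<subseteq> F i\<close>,
    and equal cardinalities force \<open>j = i\<close>.\<close>
  define f where "f x = (if \<exists>i. full i x then wedge_inclusion (THE i. full i x) ?b (s (THE i. full i x) x) else None)" for x
  have full_eq: "j = i" if "full j x" "i \<in> I" "x \<in> simplex_on (F i)" for i j x
    using that by (intro Finj) (auto simp: full_def simplex_on_def)
  have fF: "f x = wedge_inclusion i ?b (s i x)" if "i \<in> I" "x \<in> simplex_on (F i)" for i x
  proof (cases "full i x")
    case True
    then have "(THE i. full i x) = i" using full_eq that by blast
    then show ?thesis using True by (auto simp: f_def)
  next
    case False
    then have "f x = None" using full_eq[OF _ that] by (auto simp: f_def)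
    moreover have "s i x = ?b" using sb[OF that] False that by (auto simp: full_def)
    ultimately show ?thesis by (simp add: wedge_inclusion_def)
  qed
  have fA: "f x = None" if x: "x \<in> A" for x
  proof -
    obtain G where "G \<in> set Ls" "x \<in> simplex_on (set G)" using x by (auto simp: A_def)
    then have "\<not> full i x" for i using FA[of i G] by (auto simp: full_def simplex_on_def)
    then show ?thesis by (simp add: f_def)
  qed
  have notA: "i \<in> I \<Longrightarrow> x \<in> simplex_on (F i) \<Longrightarrow> x \<notin> A \<Longrightarrow> s i x \<noteq> ?b" for i x
  proof
    assume i: "i \<in> I" "x \<in> simplex_on (F i)" "x \<notin> A" "s i x = ?b"
    then obtain v where v: "v \<in> F i" "x $ v = 0" using sb by blast
    then obtain G where G: "G \<in> set Ls" "F i - {v} \<subseteq> set G" using bd[of "Ms ! i" v] i(1) by (auto simp: F_def I_def)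
    have "x \<in> simplex_on (F i - {v})" using i(2) v by (auto simp: simplex_on_def)
    then show False using simplex_on_mono[OF G(2)] G(1) i(3) by (auto simp: A_def)
  qed
  have "AR A" using AR_cone_shelling[OF shell] by (simp add: A_def)
  have "A \<noteq> {}" using \<open>AR A\<close> by (simp add: AR_ANR)
  have clA: "closed A" unfolding A_def by (intro closed_UN) (simp_all add: closed_simplex_on)
  have top: "topspace ?W = (\<Union>i\<in>I. wedge_inclusion i ?b ` topspace (nsphere n))"
    by (simp add: wedge_of_spheres_def topspace_wedge_topology I_def)
  have b: "?b \<in> topspace (nsphere n)"
    by (simp add: nsphere nsphere_basepoint_def if_distrib[of "\<lambda>t. t\<^sup>2"] sum.delta cong: if_cong)
  have None: "None \<in> topspace ?W"
    using b Ms(1) by (auto simp: top I_def wedge_inclusion_def image_iff)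
  have sS: "s i x \<in> topspace (nsphere n)" if "i \<in> I" "x \<in> simplex_on (F i)" for i x
    unfolding s_def using simplex_to_sphere_in_nsphere[OF std[OF that]] .
  have fX: "f x \<in> topspace ?W" if "x \<in> X" for x
  proof (cases "x \<in> A")
    case False
    then obtain i where i: "i \<in> I" "x \<in> simplex_on (F i)" using \<open>x \<in> X\<close> by (auto simp: X)
    then show ?thesis using sS fF by (auto simp: top)
  qed (simp add: fA None)
  have cF: "continuous_map (top_of_set (simplex_on (F i))) ?W f" if i: "i \<in> I" for i
  proof -
    have "continuous_on (simplex_on (F i)) (s i)"
      unfolding s_def by (rule continuous_on_simplex_to_sphere) (auto intro!: continuous_intros std[OF i])
    then have "continuous_map (top_of_set (simplex_on (F i))) (nsphere n) (s i)"
      using sS[OF i] unfolding nsphere euclidean_product_topology by (auto simp: continuous_map_in_subtopology)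
    moreover have "continuous_map (nsphere n) ?W (wedge_inclusion i ?b)"
      using continuous_map_wedge_inclusion[of i I "\<lambda>_. nsphere n" "\<lambda>_. ?b"] i
      by (simp add: wedge_of_spheres_def I_def)
    ultimately have "continuous_map (top_of_set (simplex_on (F i))) ?W (wedge_inclusion i ?b \<circ> s i)"
      by (rule continuous_map_compose)
    then show ?thesis by (rule continuous_map_eq) (simp add: fF[OF i])
  qed
  have cont: "continuous_map (top_of_set X) ?W f"
    unfolding continuous_map_closedin
  proof (intro conjI allI impI)
    \<comment> \<open>Closed sets suit the finite closed cover of \<open>X\<close>: each simplex has
      been treated, and on \<open>A\<close> the map is constant.\<close>
    fix C assume C: "closedin ?W C"
    have "closed {x \<in> simplex_on (F i). f x \<in> C}" if "i \<in> I" for i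
    proof -
      have "closedin (top_of_set (simplex_on (F i))) {x \<in> simplex_on (F i). f x \<in> C}"
        using cF[OF that] C by (auto simp: continuous_map_closedin)
      then show ?thesis using closed_simplex_on closedin_closed_trans by blast
    qed
    then have "closed (\<Union>i\<in>I. {x \<in> simplex_on (F i). f x \<in> C})"
      by (intro closed_UN) (auto simp: I_def)
    moreover have "closed {x \<in> A. f x \<in> C}"
    proof (cases "None \<in> C")
      case True
      then have "{x \<in> A. f x \<in> C} = A" using fA by auto
      then show ?thesis using clA by simp
    next
      case False
      then have "{x \<in> A. f x \<in> C} = {}" using fA by auto
      then show ?thesis by (simp only: closed_empty)
    qed
    ultimately have "closed ({x \<in> A. f x \<in> C} \<union> (\<Union>i\<in>I. {x \<in> simplex_on (F i). f x \<in> C}))"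
      by (intro closed_Un)
    also have "{x \<in> A. f x \<in> C} \<union> (\<Union>i\<in>I. {x \<in> simplex_on (F i). f x \<in> C}) = {x \<in> topspace (top_of_set X). f x \<in> C}"
      by (auto simp: X)
    finally show "closedin (top_of_set X) {x \<in> topspace (top_of_set X). f x \<in> C}"
      by (intro closed_subset) auto
  qed (use fX in auto)
  have "f ` X = topspace ?W"
  proof
    show "f ` X \<subseteq> topspace ?W" using fX by blast
    show "topspace ?W \<subseteq> f ` X"
    proof
      fix w assume "w \<in> topspace ?W"
      then obtain i y where i: "i \<in> I" "y \<in> topspace (nsphere n)" "w = wedge_inclusion i ?b y"
        by (auto simp: top)
      show "w \<in> f ` X"
      proof (cases "y = ?b")
        case True
        obtain x where "x \<in> A" using \<open>A \<noteq> {}\<close> by blast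
        then have "f x = w" "x \<in> X" using i(3) True fA by (auto simp: wedge_inclusion_def X)
        then show ?thesis by blast
      next
        case False
        obtain t where t: "t \<in> std_simplex n" "simplex_to_sphere n t = y"
          using simplex_to_sphere_surj[OF i(2) False] .
        define x :: "real ^ 'v" where "x = (\<chi> v. if v \<in> F i then t (the_inv_into {..n} (a i) v) else 0)"
        have xa: "x $ a i k = t k" if "k \<le> n" for k
          using that Fi[OF i(1)] by (auto simp: x_def the_inv_into_f_f)
        have "(\<Sum>v\<in>UNIV. x $ v) = (\<Sum>v\<in>F i. x $ v)"
          by (intro sum.mono_neutral_right) (auto simp: x_def)
        also have "\<dots> = (\<Sum>k\<le>n. x $ a i k)"
          using Fi[OF i(1)] by (simp add: sum.reindex)
        also have "\<dots> = (\<Sum>k\<le>n. t k)" by (simp add: xa)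
        finally have "(\<Sum>v\<in>UNIV. x $ v) = 1" using t(1) by (simp add: std_simplex_def)
        moreover have "0 \<le> x $ v" for v
        proof (cases "v \<in> F i")
          case True
          then show ?thesis using t(1) Fi(1)[OF i(1)] by (auto simp: xa std_simplex_def)
        qed (simp add: x_def)
        ultimately have x: "x \<in> simplex_on (F i)" by (auto simp: simplex_on_def x_def)
        have "s i x = simplex_to_sphere n t"
          unfolding s_def by (rule simplex_to_sphere_cong) (simp add: xa)
        then have "f x = w" using fF[OF i(1) x] t(2) i(3) by simp
        then show ?thesis using x FX[OF i(1)] by blast
      qed
    qed
  qed
  have inj: "f x = f y \<longleftrightarrow> x = y \<or> x \<in> A \<and> y \<in> A" if xX: "x \<in> X" and yX: "y \<in> X" for x y
  proof
    have fN: "\<exists>i\<in>I. x \<in> simplex_on (F i) \<and> f x = Some (i, s i x) \<and> s i x \<noteq> ?b" if "x \<in> X" "x \<notin> A" for x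
    proof -
      obtain i where i: "i \<in> I" "x \<in> simplex_on (F i)" using \<open>x \<in> X\<close> \<open>x \<notin> A\<close> by (auto simp: X)
      then show ?thesis using notA[OF i \<open>x \<notin> A\<close>] fF[OF i] by (auto simp: wedge_inclusion_def)
    qed
    assume eq: "f x = f y"
    show "x = y \<or> x \<in> A \<and> y \<in> A"
    proof (rule ccontr)
      assume not: "\<not> ?thesis"
      then have "x \<notin> A" "y \<notin> A" using fN[OF xX] fN[OF yX] fA[of x] fA[of y] eq by auto
      then obtain i where i: "i \<in> I" "x \<in> simplex_on (F i)" "y \<in> simplex_on (F i)"
          "s i x = s i y" "s i x \<noteq> ?b" "s i y \<noteq> ?b"
        using fN[OF xX] fN[OF yX] eq by auto
      have "x $ a i k = y $ a i k" if "k \<le> n" for k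
      proof (rule simplex_to_sphere_inj[OF std[OF i(1,2)] _ std[OF i(1,3)] _ _ that])
        show "\<forall>k\<le>n. x $ a i k \<noteq> 0" "\<forall>k\<le>n. y $ a i k \<noteq> 0"
          using sb[OF i(1,2)] sb[OF i(1,3)] i(5,6) Fi(1)[OF i(1)] by auto
        show "simplex_to_sphere n (\<lambda>k. x $ a i k) = simplex_to_sphere n (\<lambda>k. y $ a i k)"
          using i(4) by (simp add: s_def)
      qed
      then have "x $ v = y $ v" for v
        using i(2,3) Fi(1)[OF i(1)] by (cases "v \<in> F i") (auto simp: simplex_on_def)
      then show False using not by (simp add: vec_eq_iff)
    qed
  qed (use fA in auto)
  have "top_of_set X homotopy_equivalent_space ?W"
  proof (rule homotopy_equivalent_space_collapse)
    show "compact X" unfolding X_def by (intro compact_UN) (simp_all add: compact_simplex_on)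
    show "ANR X" using ANR_Union_simplex_on[of "set ` set (Ls @ Ms)"] by (simp add: X_def image_Un)
    show "closed A" "AR A" "A \<subseteq> X" by fact+ (auto simp: X)
    show "Hausdorff_space ?W" by (rule Hausdorff_space_wedge_of_spheres)
    show "continuous_map (top_of_set X) ?W f" "f ` X = topspace ?W" by fact+
  qed (rule inj)
  then show ?thesis by (simp add: X_def)
qed

section \<open>Barycentric subdivision\<close>

text \<open>
  A point of the barycentric subdivision gives the set \<open>U\<close> the barycentric coordinate
  \<open>card U * w U\<close>. The chain of sets is recovered from the vector \<open>layer_sum w\<close> as
  its superlevel sets, which is why the decomposition below is unique.
\<close>

definition chain_weight :: "('v set \<Rightarrow> real) \<Rightarrow> bool" where
  "chain_weight w \<longleftrightarrow> (\<forall>U. 0 \<le> w U) \<and> w {} = 0 \<and>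
     (\<forall>U V. w U \<noteq> 0 \<longrightarrow> w V \<noteq> 0 \<longrightarrow> U \<subseteq> V \<or> V \<subseteq> U)"

definition layer_sum :: "('v::finite set \<Rightarrow> real) \<Rightarrow> 'v \<Rightarrow> real" where
  "layer_sum w v = (\<Sum>U | v \<in> U. w U)"

lemma layer_sum_ge: "chain_weight w \<Longrightarrow> v \<in> U \<Longrightarrow> w U \<le> layer_sum w v" for v :: "'v::finite"
  unfolding layer_sum_def chain_weight_def by (rule member_le_sum) auto

lemma layer_sum_support:
  fixes w :: "'v::finite set \<Rightarrow> real"
  assumes "chain_weight w" "w U \<noteq> 0"
  shows "U \<subseteq> {v. layer_sum w v \<noteq> 0}"
  using layer_sum_ge[OF assms(1), of _ U] assms by (force simp: chain_weight_def dest: order.antisym)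

lemma layer_sum_fun_upd: "layer_sum (w(T := c)) v = layer_sum w v + (if v \<in> T then c - w T else 0)"
  for v :: "'v::finite"
proof (cases "v \<in> T")
  case True
  then have "(\<Sum>U | v \<in> U. (w(T := c)) U) = c + (\<Sum>U\<in>{U. v \<in> U} - {T}. w U)"
    by (subst sum.remove[of _ T]) auto
  moreover have "(\<Sum>U | v \<in> U. w U) = w T + (\<Sum>U\<in>{U. v \<in> U} - {T}. w U)"
    using True by (subst sum.remove[of _ T]) auto
  ultimately show ?thesis using True by (simp add: layer_sum_def)
next
  case False
  then show ?thesis by (auto simp: layer_sum_def intro!: sum.cong)
qed

text \<open>The union of the chain members other than \<open>T\<close> is empty or one of them, so
  some \<open>v\<close> in \<open>T\<close> avoids them all and only \<open>T\<close> contributes to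
  \<open>layer_sum w v\<close>. Everywhere on \<open>T\<close> the sum is at least
  \<open>w T\<close>.\<close>

lemma chain_weight_top:
  fixes w :: "'v::finite set \<Rightarrow> real"
  assumes w: "chain_weight w" and T: "T = {v. layer_sum w v \<noteq> 0}" "T \<noteq> {}"
  shows "w T = Min (layer_sum w ` T)"
proof -
  have sub: "U \<subseteq> T" if "w U \<noteq> 0" for U using layer_sum_support[OF w that] T by simp
  have "\<exists>v\<in>T. \<forall>U. w U \<noteq> 0 \<longrightarrow> v \<in> U \<longrightarrow> U = T"
  proof -
    define C where "C = {U. w U \<noteq> 0 \<and> U \<noteq> T}"
    have "\<Union>C \<noteq> T"
    proof (cases "C = {}")
      case False
      have "subset.chain UNIV C"
        using w by (auto simp: subset_chain_def C_def chain_weight_def)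
      then have "\<Union>C \<in> C" using False Union_in_chain[of C UNIV] by auto
      then show ?thesis by (auto simp: C_def)
    qed (use T in simp)
    moreover have "\<Union>C \<subseteq> T" using sub by (auto simp: C_def)
    ultimately obtain v where "v \<in> T" "v \<notin> \<Union>C" by blast
    then show ?thesis by (auto simp: C_def)
  qed
  then obtain v where v: "v \<in> T" "\<And>U. w U \<noteq> 0 \<Longrightarrow> v \<in> U \<Longrightarrow> U = T" by blast
  have "layer_sum w v = (\<Sum>U\<in>{T}. w U)"
    unfolding layer_sum_def using v by (intro sum.mono_neutral_right) auto
  then have "w T = layer_sum w v" by simp
  then show ?thesis
    using v(1) layer_sum_ge[OF w, of _ T] by (intro Min_eqI[symmetric]) auto
qed

text \<open>A layer-cake decomposition, obtained by peeling off the top layer. Its set is the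
  support \<open>T\<close> of \<open>x\<close>, and \<open>chain_weight_top\<close> forces its
  weight to be the minimum of \<open>x\<close> on \<open>T\<close>. Subtracting that minimum on
  \<open>T\<close> kills a coordinate, so the support shrinks.\<close>

lemma ex1_chain_weight:
  fixes x :: "'v::finite \<Rightarrow> real"
  assumes "\<And>v. 0 \<le> x v"
  shows "\<exists>!w. chain_weight w \<and> layer_sum w = x"
  using assms
proof (induction "card {v. x v \<noteq> 0}" arbitrary: x rule: less_induct)
  case less
  define T where "T = {v. x v \<noteq> 0}"
  show ?case
  proof (cases "T = {}")
    case True
    then have x0: "x = (\<lambda>v. 0)" by (auto simp: T_def)
    show ?thesis
    proof (rule ex1I[of _ "\<lambda>U. 0"])
      show "chain_weight (\<lambda>U. 0) \<and> layer_sum (\<lambda>U. 0) = x"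
        by (auto simp: chain_weight_def layer_sum_def x0)
      fix w assume w: "chain_weight w \<and> layer_sum w = x"
      then have "U \<subseteq> {}" if "w U \<noteq> 0" for U using layer_sum_support[of w U] that by (simp add: x0)
      then show "w = (\<lambda>U. 0)" using w by (fastforce simp: chain_weight_def)
    qed
  next
    case False
    define m where "m = Min (x ` T)"
    have mle: "m \<le> x v" if "v \<in> T" for v using that by (simp add: m_def)
    have "m \<in> x ` T" unfolding m_def using False by (intro Min_in) auto
    then obtain v0 where v0: "v0 \<in> T" "m = x v0" by auto
    have mpos: "0 < m" using v0 less.prems[of v0] by (auto simp: T_def)
    define y where "y v = x v - (if v \<in> T then m else 0)" for v
    have y0: "0 \<le> y v" for v using mle less.prems by (auto simp: y_def)
    have supp: "{v. y v \<noteq> 0} \<subseteq> T - {v0}" using v0 by (auto simp: y_def T_def)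
    then have "card {v. y v \<noteq> 0} < card T"
      using v0(1) by (intro psubset_card_mono) auto
    then have "\<exists>!w. chain_weight w \<and> layer_sum w = y"
      using y0 by (intro less.hyps) (simp_all add: T_def)
    then obtain w where w: "chain_weight w" "layer_sum w = y"
      and uniq: "\<And>w'. chain_weight w' \<Longrightarrow> layer_sum w' = y \<Longrightarrow> w' = w" by blast
    \<comment> \<open>The remaining layers avoid \<open>v0\<close>. They are therefore proper
      subsets of \<open>T\<close>, so adding the layer \<open>T\<close> overwrites nothing and keeps
      a chain.\<close>
    have wsub: "U \<subseteq> T - {v0}" if "w U \<noteq> 0" for U
      using layer_sum_support[OF w(1) that] w(2) supp by simp
    then have wT: "w T = 0" using v0(1) by blast
    show ?thesis
    proof (rule ex1I[of _ "w(T := m)"])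
      have "chain_weight (w(T := m))"
        using w(1) wsub mpos False by (auto simp: chain_weight_def)
      moreover have "layer_sum (w(T := m)) = x"
        by (auto simp: layer_sum_fun_upd w(2) wT y_def)
      ultimately show "chain_weight (w(T := m)) \<and> layer_sum (w(T := m)) = x" by simp
    next
      fix w' assume w': "chain_weight w' \<and> layer_sum w' = x"
      then have "w' T = m" using chain_weight_top[of w' T] False by (simp add: T_def m_def)
      have "chain_weight (w'(T := 0))" using w' by (auto simp: chain_weight_def)
      moreover have "layer_sum (w'(T := 0)) = y"
        using w' \<open>w' T = m\<close> by (auto simp: layer_sum_fun_upd y_def)
      ultimately have "w'(T := 0) = w" by (rule uniq)
      then show "w' = w(T := m)" using \<open>w' T = m\<close> by auto
    qed
  qed
qed

section \<open>Compactness and the topology of finite complexes\<close>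

lemma closed_simplex_closed: "closed (closed_simplex \<sigma>)" if "finite \<sigma>"
proof -
  have "closed {t::'a \<Rightarrow> real. \<forall>v. 0 \<le> t v}" "closed {t::'a \<Rightarrow> real. \<forall>v. v \<notin> \<sigma> \<longrightarrow> t v = 0}"
    "closed {t::'a \<Rightarrow> real. sum t \<sigma> = 1}"
    by (intro closed_Collect_all closed_Collect_le closed_Collect_imp closed_Collect_eq
        open_Collect_const continuous_intros continuous_on_product_coordinates)+
  then show ?thesis
    unfolding closed_simplex_def by (intro closed_Collect_conj)
qed

lemma compact_closed_simplex: "compact (closed_simplex \<sigma>)" if "finite \<sigma>"
proof -
  have "compact (PiE UNIV (\<lambda>_::'a. {0..1::real}))"
    unfolding compactin_euclidean_iff[symmetric] euclidean_product_topology[symmetric]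
    by (subst compactin_PiE) (auto simp: euclidean_product_topology)
  moreover have "closed_simplex \<sigma> \<subseteq> PiE UNIV (\<lambda>_::'a. {0..1::real})"
  proof
    fix t assume t: "t \<in> closed_simplex \<sigma>"
    have "t v \<le> 1" for v
      using t that member_le_sum[of v \<sigma> t] by (cases "v \<in> \<sigma>") (auto simp: closed_simplex_def)
    then show "t \<in> PiE UNIV (\<lambda>_. {0..1})" using t by (auto simp: closed_simplex_def)
  qed
  ultimately show ?thesis
    using compact_Int_closed[OF _ closed_simplex_closed[OF that]] by (metis inf.absorb_iff2)
qed

text \<open>If \<open>U\<close> has an open trace on each closed simplex, what it leaves of that
  simplex is closed in the whole function space, and finitely many such remainders have a closed
  union.\<close>

lemma complex_realization_finite:
  assumes "finite K" "\<And>\<sigma>. \<sigma> \<in> K \<Longrightarrow> finite \<sigma>"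
  shows "complex_realization K = top_of_set (\<Union> (closed_simplex ` K))"
proof (rule topology_eq[THEN iffD2], intro allI)
  fix U :: "('a \<Rightarrow> real) set"
  let ?X = "\<Union> (closed_simplex ` K)"
  show "openin (complex_realization K) U \<longleftrightarrow> openin (top_of_set ?X) U"
  proof
    assume "openin (complex_realization K) U"
    then have U: "U \<subseteq> ?X" "\<And>\<sigma>. \<sigma> \<in> K \<Longrightarrow> openin (top_of_set (closed_simplex \<sigma>)) (closed_simplex \<sigma> \<inter> U)"
      by (auto simp: openin_complex_realization)
    have "closed (closed_simplex \<sigma> - U)" if "\<sigma> \<in> K" for \<sigma>
    proof -
      have "closedin (top_of_set (closed_simplex \<sigma>)) (closed_simplex \<sigma> - (closed_simplex \<sigma> \<inter> U))"
        using U(2)[OF that] by (simp add: closedin_diff)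
      moreover have "closed_simplex \<sigma> - (closed_simplex \<sigma> \<inter> U) = closed_simplex \<sigma> - U" by blast
      ultimately show ?thesis
        using closed_simplex_closed[OF assms(2)[OF that]] closedin_closed_trans by metis
    qed
    then have "closed (\<Union>\<sigma>\<in>K. closed_simplex \<sigma> - U)"
      using assms(1) by (intro closed_UN) auto
    then have "openin (top_of_set ?X) (?X - (\<Union>\<sigma>\<in>K. closed_simplex \<sigma> - U))"
      by (intro openin_diff closed_subset) auto
    also have "?X - (\<Union>\<sigma>\<in>K. closed_simplex \<sigma> - U) = U" using U(1) by blast
    finally show "openin (top_of_set ?X) U" .
  next
    assume U: "openin (top_of_set ?X) U"
    then obtain T where T: "open T" "U = ?X \<inter> T" by (auto simp: openin_open)
    have "closed_simplex \<sigma> \<inter> U = closed_simplex \<sigma> \<inter> T" if "\<sigma> \<in> K" for \<sigma> using that T by blast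
    then show "openin (complex_realization K) U"
      unfolding openin_complex_realization using T by (auto simp: openin_open)
  qed
qed

text \<open>By \<open>down\<close> the sets \<open>g S\<close> form a simplicial complex, and
  \<open>P\<close> is its face poset with the order reversed, which leaves the chains the same.
  Bijectivity of the subdivision map comes from the unique decomposition into weighted
  chains.\<close>

lemma poset_realization_homeomorphic_simplicial_complex:
  fixes P :: "'a::order set" and g :: "'a \<Rightarrow> 'v::finite set"
  assumes P: "finite P" and inj: "inj_on g P"
    and anti: "\<And>S T. S \<in> P \<Longrightarrow> T \<in> P \<Longrightarrow> S \<le> T \<longleftrightarrow> g T \<subseteq> g S"
    and ne: "{} \<notin> g ` P" and down: "\<And>U V. U \<in> g ` P \<Longrightarrow> V \<subseteq> U \<Longrightarrow> V \<noteq> {} \<Longrightarrow> V \<in> g ` P"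
  shows "poset_realization P homeomorphic_space top_of_set (\<Union>S\<in>P. simplex_on (g S))"
proof -
  let ?R = "\<Union> (closed_simplex ` order_complex P)" and ?X = "\<Union>S\<in>P. simplex_on (g S)"
  have K: "finite (order_complex P)" "\<And>\<sigma>. \<sigma> \<in> order_complex P \<Longrightarrow> finite \<sigma>"
    using P finite_subset[of "order_complex P" "Pow P"] by (auto simp: order_complex_def)
  define w where "w t U = (if U \<in> g ` P then t (inv_into P g U) / card U else 0)" for t :: "'a \<Rightarrow> real" and U
  have wg: "w t (g S) = t S / card (g S)" if "S \<in> P" for t S
    using that inj by (simp add: w_def)
  have card: "0 < card (g S)" if "S \<in> P" for S using that ne by (auto simp: card_gt_0_iff)
  \<comment> \<open>The linear map that sends the vertex \<open>S\<close> to the barycentre of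
    \<open>simplex_on (g S)\<close>. The division by \<open>card (g S)\<close> spreads
    \<open>t S\<close> evenly over the vertices, which makes \<open>h t\<close> the layer sum of
    \<open>w t\<close>.\<close>
  define h where "h t = (\<chi> v. \<Sum>S\<in>P. if v \<in> g S then t S / card (g S) else 0)" for t :: "'a \<Rightarrow> real"
  have hw: "h t $ v = layer_sum (w t) v" for t v
  proof -
    have "h t $ v = (\<Sum>S\<in>P. if v \<in> g S then w t (g S) else 0)"
      unfolding h_def vec_lambda_beta by (intro sum.cong) (auto simp: wg)
    also have "\<dots> = (\<Sum>U\<in>g ` P. if v \<in> U then w t U else 0)"
      using inj by (simp add: sum.reindex)
    also have "\<dots> = layer_sum (w t) v"
      unfolding layer_sum_def by (rule sum.mono_neutral_cong) (use P in \<open>auto simp: w_def\<close>)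
    finally show ?thesis .
  qed
  have chain: "chain_weight (w t)" if t: "t \<in> closed_simplex \<sigma>" and \<sigma>: "\<sigma> \<in> order_complex P" for t \<sigma>
    unfolding chain_weight_def
  proof (intro conjI allI impI)
    show "0 \<le> w t U" for U using t by (simp add: w_def closed_simplex_def)
    show "w t {} = 0" using ne by (simp add: w_def)
    have supp: "\<exists>S\<in>P. U = g S \<and> t S \<noteq> 0" if "w t U \<noteq> 0" for U
      using that inj by (auto simp: w_def split: if_splits)
    fix U V assume "w t U \<noteq> 0" "w t V \<noteq> 0"
    then obtain S T where "U = g S" "V = g T" "S \<in> P" "T \<in> P" "t S \<noteq> 0" "t T \<noteq> 0"
      using supp[of U] supp[of V] by blast
    moreover from this have "S \<in> \<sigma>" "T \<in> \<sigma>" using t by (auto simp: closed_simplex_def)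
    then have "S \<le> T \<or> T \<le> S" using \<sigma> by (auto simp: order_complex_def Complete_Partial_Order.chain_def)
    ultimately show "U \<subseteq> V \<or> V \<subseteq> U" using anti by blast
  qed
  have sum_h: "(\<Sum>v\<in>UNIV. h t $ v) = sum t P" for t
  proof -
    have "(\<Sum>v\<in>UNIV. h t $ v) = (\<Sum>S\<in>P. \<Sum>v\<in>UNIV. if v \<in> g S then t S / card (g S) else 0)"
      unfolding h_def vec_lambda_beta by (rule sum.swap)
    also have "\<dots> = (\<Sum>S\<in>P. t S)"
      using card ne by (intro sum.cong) (auto simp: sum.If_cases)
    finally show ?thesis .
  qed
  have hX: "h t \<in> ?X" if t: "t \<in> closed_simplex \<sigma>" and \<sigma>: "\<sigma> \<in> order_complex P" for t \<sigma>
  proof -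
    have \<sigma>': "finite \<sigma>" "\<sigma> \<noteq> {}" "\<sigma> \<subseteq> P" using \<sigma> by (auto simp: order_complex_def)
    \<comment> \<open>Since \<open>g\<close> reverses the order, the least element of the chain has
      the largest face, which contains all the others.\<close>
    obtain S where S: "S \<in> \<sigma>" "\<And>T. T \<in> \<sigma> \<Longrightarrow> \<not> T < S"
      using finite_has_minimal[OF \<sigma>'(1,2)] by (metis less_le)
    have "S \<le> T" if "T \<in> \<sigma>" for T
      using S that \<sigma> by (auto simp: order_complex_def Complete_Partial_Order.chain_def less_le)
    then have sub: "g T \<subseteq> g S" if "T \<in> \<sigma>" for T using that S anti \<sigma>' by blast
    have "sum t P = 1"
      using t \<sigma>' P sum.mono_neutral_left[of P \<sigma> t] by (auto simp: closed_simplex_def)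
    moreover have "h t $ v = 0" if "v \<notin> g S" for v
      unfolding h_def vec_lambda_beta
    proof (intro sum.neutral ballI)
      fix T assume "T \<in> P"
      show "(if v \<in> g T then t T / card (g T) else 0) = 0"
        using sub[of T] that t by (auto simp: closed_simplex_def)
    qed
    moreover have "0 \<le> h t $ v" for v
      using t by (auto simp: h_def closed_simplex_def intro!: sum_nonneg)
    ultimately have "h t \<in> simplex_on (g S)" by (simp add: simplex_on_def sum_h)
    then show ?thesis using S \<sigma>' by auto
  qed
  have "inj_on h ?R"
  proof (rule inj_onI)
    fix s t assume s: "s \<in> ?R" and t: "t \<in> ?R" and eq: "h s = h t"
    have "0 \<le> h s $ v" for v using hX s by (force simp: simplex_on_def)
    then have "w s = w t"
      using ex1_chain_weight[of "\<lambda>v. h s $ v"] chain s t eq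
      by (metis (no_types, lifting) UN_E ext hw)
    have "s S = t S" for S
    proof (cases "S \<in> P")
      case True
      then show ?thesis using fun_cong[OF \<open>w s = w t\<close>, of "g S"] card[OF True] by (auto simp: wg)
    next
      case False
      then have "r S = 0" if "r \<in> ?R" for r
        using that by (auto simp: order_complex_def closed_simplex_def)
      from this[OF s] this[OF t] show ?thesis by simp
    qed
    then show "s = t" by blast
  qed
  moreover have "h ` ?R = ?X"
  proof
    show "h ` ?R \<subseteq> ?X" using hX by blast
    show "?X \<subseteq> h ` ?R"
    proof
      fix x assume "x \<in> ?X"
      then obtain S0 where S0: "S0 \<in> P" "x \<in> simplex_on (g S0)" by blast
      then obtain u where u: "chain_weight u" "layer_sum u = ($) x"
        using ex1_chain_weight[of "($) x"] by (auto simp: simplex_on_def)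
      \<comment> \<open>Each layer lies in the support of \<open>x\<close>, hence in the face
        \<open>g S0\<close>, so closure under faces makes it a face.\<close>
      have uP: "U \<in> g ` P" if "u U \<noteq> 0" for U
      proof (rule down)
        show "g S0 \<in> g ` P" using S0 by blast
        show "U \<subseteq> g S0" using layer_sum_support[OF u(1) that] S0(2) by (auto simp: u(2) simplex_on_def)
        show "U \<noteq> {}" using that u(1) by (auto simp: chain_weight_def)
      qed
      define t where "t S = (if S \<in> P then card (g S) * u (g S) else 0)" for S
      have "w t U = u U" for U
      proof (cases "U \<in> g ` P")
        case True
        then obtain S where "S \<in> P" "U = g S" by blast
        then show ?thesis using card[of S] by (auto simp: wg t_def)
      next
        case False
        then show ?thesis using uP[of U] by (auto simp: w_def)
      qed
      then have ht: "h t = x" by (simp add: vec_eq_iff hw u(2) ext[of "w t" u])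
      then have sum: "sum t P = 1" using S0(2) sum_h[of t] by (simp add: simplex_on_def)
      define \<sigma> where "\<sigma> = {S \<in> P. t S \<noteq> 0}"
      have "sum t \<sigma> = sum t P" using P by (intro sum.mono_neutral_left) (auto simp: \<sigma>_def)
      then have "sum t \<sigma> = 1" using sum by simp
      moreover have "0 \<le> t S" for S using u(1) by (simp add: t_def chain_weight_def)
      moreover have "t S = 0" if "S \<notin> \<sigma>" for S using that by (auto simp: \<sigma>_def t_def)
      ultimately have "t \<in> closed_simplex \<sigma>" by (simp add: closed_simplex_def)
      moreover have "\<sigma> \<in> order_complex P"
        unfolding order_complex_def Complete_Partial_Order.chain_def
      proof (intro CollectI conjI ballI)
        show "\<sigma> \<subseteq> P" "finite \<sigma>" using P by (auto simp: \<sigma>_def)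
        show "\<sigma> \<noteq> {}" using \<open>sum t \<sigma> = 1\<close> by auto
        fix S T assume "S \<in> \<sigma>" "T \<in> \<sigma>"
        then have "u (g S) \<noteq> 0" "u (g T) \<noteq> 0" "S \<in> P" "T \<in> P" by (auto simp: \<sigma>_def t_def)
        then show "S \<le> T \<or> T \<le> S" using u(1) anti by (auto simp: chain_weight_def)
      qed
      ultimately show "x \<in> h ` ?R" using ht by blast
    qed
  qed
  moreover have "continuous_on UNIV h"
    unfolding h_def
  proof (intro continuous_on_vec_lambda continuous_on_sum)
    fix v :: 'v and S
    show "continuous_on UNIV (\<lambda>t::'a \<Rightarrow> real. if v \<in> g S then t S / card (g S) else 0)"
      by (cases "v \<in> g S") (auto simp: divide_inverse intro!: continuous_intros)
  qed
  then have "continuous_on ?R h" by (rule continuous_on_subset) simp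
  moreover have "compact ?R"
    using K by (intro compact_UN) (auto simp: compact_closed_simplex)
  ultimately have "homeomorphic_map (top_of_set ?R) (top_of_set ?X) h"
    by (intro continuous_imp_homeomorphic_map)
      (auto simp: compact_space_subtopology Hausdorff_space_subtopology)
  then have "top_of_set ?R homeomorphic_space top_of_set ?X"
    by (rule homeomorphic_map_imp_homeomorphic_space)
  moreover have "poset_realization P = top_of_set ?R"
    unfolding poset_realization_def by (rule complex_realization_finite) (use K in auto)
  ultimately show ?thesis by simp
qed

section \<open>Regular binary matroids of rank three\<close>

text \<open>The vectors represent themselves; the coordinates only have to be numbered, since
  \<open>binary_matroid\<close> indexes them by natural numbers.\<close>

lemma binary_linear_matroid:
  fixes S :: "(bit ^ 'n::finite) set"
  shows "binary_matroid (linear_matroid S)"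
proof -
  obtain h :: "nat \<Rightarrow> 'n" where h: "bij_betw h {0..<CARD('n)} UNIV"
    using ex_bij_betw_nat_finite[of "UNIV :: 'n set"] by auto
  have sum0: "(\<forall>j<CARD('n). (\<Sum>e\<in>I. c e * e $ h j) = 0) \<longleftrightarrow> (\<Sum>e\<in>I. c e *s e) = 0"
    for I and c :: "bit ^ 'n \<Rightarrow> bit"
  proof -
    have "(\<forall>j<CARD('n). (\<Sum>e\<in>I. c e * e $ h j) = 0) \<longleftrightarrow>
        (\<forall>k\<in>h ` {0..<CARD('n)}. (\<Sum>e\<in>I. c e * e $ k) = 0)" by auto
    also have "h ` {0..<CARD('n)} = UNIV" using h by (rule bij_betw_imp_surj_on)
    finally show ?thesis by (simp add: vec_eq_iff)
  qed
  have "(I \<in> indep (linear_matroid S)) \<longleftrightarrow>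
      (\<forall>c. (\<forall>j<CARD('n). (\<Sum>e\<in>I. c e * e $ h j) = 0) \<longrightarrow> (\<forall>e\<in>I. c e = 0))" if "I \<subseteq> S" for I
    unfolding sum0 using that by (simp add: linear_matroid_def vec.independent_explicit)
  then show ?thesis
    unfolding binary_matroid_def
    by (intro conjI is_matroid_linear_matroid exI[of _ "CARD('n)"] exI[of _ "\<lambda>e j. e $ h j"])
      (simp add: linear_matroid_def)
qed

text \<open>Both excluded minors have seven elements, so a proper subset is too small to have one,
  while the full set is the Fano matroid and a minor of itself.\<close>

lemma regular_linear_matroid_iff:
  fixes S :: "(bit ^ 3) set"
  assumes "S \<subseteq> UNIV - {0}"
  shows "regular_matroid (linear_matroid S) \<longleftrightarrow> S \<noteq> UNIV - {0}"
proof
  assume reg: "regular_matroid (linear_matroid S)"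
  show "S \<noteq> UNIV - {0}"
  proof
    assume "S = UNIV - {0}"
    then have M: "linear_matroid S = fano_matroid" by (simp add: fano_matroid_def)
    have "bases_of fano_matroid {} = {{}}"
      by (auto simp: bases_of_def fano_matroid_def linear_matroid_def vec.independent_empty)
    then have "fano_matroid = delete_matroid (contract_matroid fano_matroid {}) {}"
      by (auto simp: delete_matroid_def contract_matroid_def fano_matroid_def linear_matroid_def)
    then have "is_minor_of fano_matroid fano_matroid"
      unfolding is_minor_of_def by blast
    moreover have "matroid_isomorphic fano_matroid fano_matroid"
      unfolding matroid_isomorphic_def by (rule exI[of _ id]) auto
    ultimately show False using reg by (auto simp: regular_matroid_def M)
  qed
next
  assume ne: "S \<noteq> UNIV - {0}"
  have card: "card S < card (UNIV - {0} :: (bit ^ 3) set)"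
    using assms ne by (intro psubset_card_mono) auto
  have "\<not> (matroid_isomorphic N fano_matroid \<or> matroid_isomorphic N (dual_matroid fano_matroid))"
    if "is_minor_of N (linear_matroid S)" for N
  proof
    assume iso: "matroid_isomorphic N fano_matroid \<or> matroid_isomorphic N (dual_matroid fano_matroid)"
    have "ground (dual_matroid fano_matroid) = UNIV - {0}" "ground fano_matroid = UNIV - {0}"
      by (simp_all add: dual_matroid_def fano_matroid_def linear_matroid_def)
    then have "card (ground N) = card (UNIV - {0} :: (bit ^ 3) set)"
      using iso unfolding matroid_isomorphic_def by (metis bij_betw_same_card)
    moreover have "ground N \<subseteq> S"
      using that by (auto simp: is_minor_of_def delete_matroid_def contract_matroid_def linear_matroid_def)
    then have "card (ground N) \<le> card S" by (intro card_mono) auto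
    ultimately show False using card by simp
  qed
  then show "regular_matroid (linear_matroid S)"
    using binary_linear_matroid by (auto simp: regular_matroid_def)
qed

lemma matroid_rank_linear_matroid_eq_iff:
  fixes S :: "(bit ^ 'n::finite) set"
  shows "matroid_rank (linear_matroid S) = CARD('n) \<longleftrightarrow>
    (\<exists>B\<subseteq>S. vec.independent B \<and> card B = CARD('n))"
proof -
  let ?I = "indep (linear_matroid S)"
  have le: "card B \<le> CARD('n)" if "B \<in> ?I" for B
    using that vec.independent_card_le_dim[of B UNIV] by (simp add: linear_matroid_def vec.dim_UNIV card_cart_basis)
  have "{} \<in> ?I" by (simp add: linear_matroid_def vec.independent_empty)
  then have "Max (card ` ?I) \<in> card ` ?I" by (intro Max_in) auto
  moreover have "card B \<le> Max (card ` ?I)" if "B \<in> ?I" for B using that by (intro Max_ge) auto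
  ultimately have "matroid_rank (linear_matroid S) = CARD('n) \<longleftrightarrow> (\<exists>B\<in>?I. card B = CARD('n))"
    unfolding matroid_rank_def using le by (metis (no_types, lifting) imageE le_antisym)
  then show ?thesis by (auto simp: linear_matroid_def)
qed

lemma bit_vec_add_self: "x + x = (0 :: bit ^ 'n)"
  by (simp add: vec_eq_iff)

text \<open>Over two scalars a nontrivial relation is a vanishing sum of some of the vectors. One
  vector is ruled out by being nonzero, two by being distinct; only the sum of all three is
  left.\<close>

lemma independent_triple_iff:
  fixes x y z :: "bit ^ 'n::finite"
  assumes "x \<noteq> y" "x \<noteq> z" "y \<noteq> z" "x \<noteq> 0" "y \<noteq> 0" "z \<noteq> 0"
  shows "vec.independent {x, y, z} \<longleftrightarrow> x + y \<noteq> z"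
proof
  assume ind: "vec.independent {x, y, z}"
  show "x + y \<noteq> z"
  proof
    assume "x + y = z"
    then have "z \<in> vec.span {x, y}"
      using vec.span_add[OF vec.span_base vec.span_base, of x "{x, y}" y] by simp
    then show False using ind assms by (auto simp: vec.dependent_def insert_commute[of _ z] insert_Diff_if)
  qed
next
  assume ne: "x + y \<noteq> z"
  have add0: "u + v = 0 \<longleftrightarrow> u = v" for u v :: "bit ^ 'n"
    by (metis add.right_neutral add_left_cancel bit_vec_add_self)
  have sum3: "x = y + z \<longleftrightarrow> x + y = z"
    by (metis add.assoc add0)
  have "c x = 0 \<and> c y = 0 \<and> c z = 0" if "c x *s x + (c y *s y + c z *s z) = 0" for c :: "bit ^ 'n \<Rightarrow> bit"
    by (cases "c x"; cases "c y"; cases "c z"; use that assms ne in \<open>simp add: add0 sum3\<close>)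
  then show "vec.independent {x, y, z}"
    using assms by (simp add: vec.independent_explicit)
qed

section \<open>The Fano plane\<close>

text \<open>
  The binary digits of \<open>n < 8\<close> are the coordinates of a vector (the coercion to \<^typ>\<open>bit\<close>
  reduces modulo 2), so statements about the Fano plane become decidable statements about numbers.
\<close>

definition fano_point :: "nat \<Rightarrow> bit ^ 3" where
  "fano_point n = vector [of_nat (n div 4), of_nat (n div 2), of_nat n]"

text \<open>The bitwise sum of the last three digits vanishes. The quotients keep their higher
  digits, which parity ignores.\<close>

definition fano_collinear :: "nat \<Rightarrow> nat \<Rightarrow> nat \<Rightarrow> bool" where
  "fano_collinear a b c \<longleftrightarrow>
     even (a div 4 + b div 4 + c div 4) \<and> even (a div 2 + b div 2 + c div 2) \<and> even (a + b + c)"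

text \<open>
  Together the two lists contain the complements of the 28 bases. In the lexicographic shelling, the
  sphere facets are the ones whose whole boundary is covered by earlier facets; the cone facets are
  the others, listed backwards.
\<close>

definition cone_facets :: "nat list list" where
  "cone_facets = [[2, 3, 5, 7], [2, 3, 5, 6], [2, 3, 4, 7], [2, 3, 4, 6], [1, 5, 6, 7], [1, 4, 6, 7],
     [1, 4, 5, 7], [1, 4, 5, 6], [1, 3, 6, 7], [1, 3, 5, 6], [1, 3, 4, 7], [1, 3, 4, 5], [1, 2, 6, 7],
     [1, 2, 5, 7], [1, 2, 4, 6], [1, 2, 4, 5], [1, 2, 3, 7], [1, 2, 3, 6], [1, 2, 3, 5], [1, 2, 3, 4]]"

definition sphere_facets :: "nat list list" where
  "sphere_facets = [[2, 4, 5, 6], [2, 4, 5, 7], [2, 4, 6, 7], [2, 5, 6, 7],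
     [3, 4, 5, 6], [3, 4, 5, 7], [3, 4, 6, 7], [3, 5, 6, 7]]"

lemma cone_shelling_cone_facets: "cone_shelling (map set cone_facets)"
  by code_simp

lemma sphere_facets_boundary:
  "\<forall>F\<in>set sphere_facets. distinct F \<and> length F = Suc 3 \<and> (\<forall>v\<in>set F. \<exists>G\<in>set cone_facets. set F - {v} \<subseteq> set G)"
  by code_simp

lemma sphere_facets_new: "\<forall>F\<in>set sphere_facets. \<forall>G\<in>set cone_facets. \<not> set F \<subseteq> set G"
  by code_simp

lemma sphere_facets_distinct: "distinct (map set sphere_facets)"
  by code_simp

lemma facet_in_range: "\<forall>F\<in>set (cone_facets @ sphere_facets). F \<noteq> [] \<and> set F \<subseteq> set [1..<8]"
  by code_simp

text \<open>This check shows that the listed sets are faces; its counterpart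
  \<open>noncollinear_complement_facet\<close> shows that they cover all faces. Ranges are written
  \<open>set [1..<8]\<close> so that evaluation can enumerate them.\<close>

lemma facet_complement_noncollinear:
  "\<forall>F\<in>set (cone_facets @ sphere_facets). \<exists>a\<in>set [1..<8]. \<exists>b\<in>set [1..<8]. \<exists>c\<in>set [1..<8].
     a \<noteq> b \<and> a \<noteq> c \<and> b \<noteq> c \<and> \<not> fano_collinear a b c \<and> a \<notin> set F \<and> b \<notin> set F \<and> c \<notin> set F"
  by code_simp

lemma noncollinear_complement_facet:
  "\<forall>a\<in>set [1..<8]. \<forall>b\<in>set [1..<8]. \<forall>c\<in>set [1..<8].
     a \<noteq> b \<longrightarrow> a \<noteq> c \<longrightarrow> b \<noteq> c \<longrightarrow> \<not> fano_collinear a b c \<longrightarrow>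
     (\<exists>F\<in>set (cone_facets @ sphere_facets). set [1..<8] - {a, b, c} \<subseteq> set F)"
  by code_simp

lemma of_nat_bit_eq_0_iff: "(of_nat n :: bit) = 0 \<longleftrightarrow> even n"
  by (induction n) auto

lemma bit_add_eq_iff: "(x::bit) + y = z \<longleftrightarrow> x + y + z = 0"
  by (cases x; cases y; cases z) auto

lemma fano_point_add_eq_iff: "fano_point a + fano_point b = fano_point c \<longleftrightarrow> fano_collinear a b c"
proof -
  have "(of_nat i + of_nat j = (of_nat k :: bit)) \<longleftrightarrow> even (i + j + k)" for i j k
    using bit_add_eq_iff[of "of_nat i" "of_nat j" "of_nat k"] of_nat_bit_eq_0_iff[of "i + j + k"] by simp
  then show ?thesis
    by (simp add: vec_eq_iff forall_3 fano_point_def fano_collinear_def del: even_add)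
qed

lemma fano_point_0: "fano_point 0 = 0"
  by (simp add: fano_point_def vec_eq_iff forall_3)

lemma inj_on_fano_point: "inj_on fano_point {0..<8}"
proof -
  \<comment> \<open>As \<open>fano_point 0\<close> is the zero vector, equality of two points is
    collinearity with 0.\<close>
  have "\<forall>a\<in>set [0..<8]. \<forall>b\<in>set [0..<8]. fano_collinear a 0 b \<longrightarrow> a = b"
    by code_simp
  then show ?thesis
    unfolding inj_on_def using fano_point_add_eq_iff[of _ 0] fano_point_0 by (metis add.right_neutral set_upt)
qed

lemma fano_point_image: "fano_point ` {1..<8} = UNIV - {0}"
proof -
  have "x \<in> fano_point ` {0..<8}" for x
  proof -
    define n :: nat where "n = 4 * of_bool (x $ 1 = 1) + 2 * of_bool (x $ 2 = 1) + of_bool (x $ 3 = 1)"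
    have "x = fano_point n" "n < 8"
      by (cases "x $ 1"; cases "x $ 2"; cases "x $ 3"; simp add: n_def fano_point_def vec_eq_iff forall_3)+
    then show ?thesis by auto
  qed
  then have "fano_point ` {0..<8} = UNIV" by auto
  moreover have "fano_point ` {1..<8} = fano_point ` {0..<8} - {fano_point 0}"
    using inj_on_image_set_diff[OF inj_on_fano_point, of "{0..<8}" "{0}"] by (simp add: atLeast1_lessThan_eq_remove0 lessThan_atLeast0)
  ultimately show ?thesis by (simp add: fano_point_0)
qed

text \<open>Absorbs the matroid theory: regularity has become properness, and full rank the presence
  of a basis, expressed by digits.\<close>

lemma IR_3_eq:
  "(IR :: (bit ^ 3) set set) =
     {S. S \<subseteq> UNIV - {0} \<and> S \<noteq> UNIV - {0} \<and>
       (\<exists>a\<in>{1..<8}. \<exists>b\<in>{1..<8}. \<exists>c\<in>{1..<8}. a \<noteq> b \<and> a \<noteq> c \<and> b \<noteq> c \<and> \<not> fano_collinear a b c \<and>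
          fano_point a \<in> S \<and> fano_point b \<in> S \<and> fano_point c \<in> S)}"
proof -
  let ?E = "UNIV - {0} :: (bit ^ 3) set"
  have inj: "inj_on fano_point {1..<8}"
    using inj_on_fano_point by (rule inj_on_subset) auto
  have ne0: "fano_point a \<noteq> 0" if "a \<in> {1..<8}" for a
    using fano_point_image that by blast
  have ind: "vec.independent {fano_point a, fano_point b, fano_point c} \<longleftrightarrow> \<not> fano_collinear a b c"
    if "a \<in> {1..<8}" "b \<in> {1..<8}" "c \<in> {1..<8}" "a \<noteq> b" "a \<noteq> c" "b \<noteq> c" for a b c
    by (subst independent_triple_iff)
      (use that in \<open>simp_all add: inj_on_eq_iff[OF inj] ne0 fano_point_add_eq_iff\<close>)
  have basis_iff: "(\<exists>B\<subseteq>S. vec.independent B \<and> card B = CARD(3)) \<longleftrightarrow>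
       (\<exists>a\<in>{1..<8}. \<exists>b\<in>{1..<8}. \<exists>c\<in>{1..<8}. a \<noteq> b \<and> a \<noteq> c \<and> b \<noteq> c \<and> \<not> fano_collinear a b c \<and>
          fano_point a \<in> S \<and> fano_point b \<in> S \<and> fano_point c \<in> S)" (is "?L \<longleftrightarrow> ?R")
    if S: "S \<subseteq> ?E" for S
  proof
    assume ?L
    then obtain B where B: "B \<subseteq> S" "vec.independent B" "card B = 3" by auto
    then obtain x y z where xyz: "B = {x, y, z}" "x \<noteq> y" "x \<noteq> z" "y \<noteq> z" by (auto simp: card_3_iff)
    then have "x \<in> ?E" "y \<in> ?E" "z \<in> ?E" using B(1) S by auto
    then obtain a b c where abc: "a \<in> {1..<8}" "x = fano_point a" "b \<in> {1..<8}" "y = fano_point b"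
        "c \<in> {1..<8}" "z = fano_point c"
      unfolding fano_point_image[symmetric] by blast
    then have "\<not> fano_collinear a b c" using ind[of a b c] B(2) xyz by auto
    then show ?R using abc xyz B(1) by (intro bexI[of _ a] bexI[of _ b] bexI[of _ c]) auto
  next
    assume ?R
    then obtain a b c where abc: "a \<in> {1..<8}" "b \<in> {1..<8}" "c \<in> {1..<8}" "a \<noteq> b" "a \<noteq> c" "b \<noteq> c"
      "\<not> fano_collinear a b c" "fano_point a \<in> S" "fano_point b \<in> S" "fano_point c \<in> S" by blast
    then have "card {fano_point a, fano_point b, fano_point c} = 3"
      using inj_on_eq_iff[OF inj] by simp
    then show ?L using ind[of a b c] abc
      by (intro exI[of _ "{fano_point a, fano_point b, fano_point c}"]) auto
  qed
  show ?thesis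
    unfolding IR_def
    by (intro Collect_cong conj_cong refl)
      (simp_all only: regular_linear_matroid_iff matroid_rank_linear_matroid_eq_iff basis_iff)
qed

theorem theorem2p16:
  shows "poset_realization (IR :: (bit ^ 3) set set) homotopy_equivalent_space wedge_of_spheres 8 3"
proof -
  let ?E = "UNIV - {0} :: (bit ^ 3) set" and ?P = "IR :: (bit ^ 3) set set"
  define g where "g S = ?E - S" for S :: "(bit ^ 3) set"
  have PE: "S \<subseteq> ?E" if "S \<in> ?P" for S using that by (simp add: IR_def)
  have gg: "g (g S) = S" if "S \<subseteq> ?E" for S using that by (auto simp: g_def)
  have gP: "U \<in> g ` ?P \<longleftrightarrow> U \<subseteq> ?E \<and> U \<noteq> {} \<and>
      (\<exists>a\<in>{1..<8}. \<exists>b\<in>{1..<8}. \<exists>c\<in>{1..<8}. a \<noteq> b \<and> a \<noteq> c \<and> b \<noteq> c \<and> \<not> fano_collinear a b c \<and>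
          fano_point a \<notin> U \<and> fano_point b \<notin> U \<and> fano_point c \<notin> U)" (is "_ \<longleftrightarrow> ?R U") for U
  proof -
    have "U \<in> g ` ?P \<longleftrightarrow> U \<subseteq> ?E \<and> g U \<in> ?P"
    proof
      assume "U \<in> g ` ?P"
      then obtain S where S: "S \<in> ?P" "U = g S" by blast
      then have "g U = S" using gg PE by simp
      then show "U \<subseteq> ?E \<and> g U \<in> ?P" using S by (auto simp: g_def)
    next
      assume "U \<subseteq> ?E \<and> g U \<in> ?P"
      then show "U \<in> g ` ?P" using gg[of U] by (metis imageI)
    qed
    also have "\<dots> \<longleftrightarrow> ?R U"
    proof -
      have "fano_point a \<in> ?E" if "a \<in> {1..<8}" for a using fano_point_image that by blast
      then have "fano_point a \<in> g U \<longleftrightarrow> fano_point a \<notin> U" if "a \<in> {1..<8}" for a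
        using that by (simp add: g_def)
      moreover have "U \<subseteq> ?E \<Longrightarrow> g U = ?E \<longleftrightarrow> U = {}" by (auto simp: g_def)
      moreover have "g U \<subseteq> ?E" by (auto simp: g_def)
      ultimately show ?thesis unfolding IR_3_eq mem_Collect_eq by (smt (verit))
    qed
    finally show ?thesis .
  qed
  define Ls Ms where "Ls = map (map fano_point) cone_facets" and "Ms = map (map fano_point) sphere_facets"
  have "poset_realization ?P homeomorphic_space top_of_set (\<Union>S\<in>?P. simplex_on (g S))"
  proof (rule poset_realization_homeomorphic_simplicial_complex)
    show "inj_on g ?P" using gg PE by (metis inj_onI)
    show "S \<subseteq> T \<longleftrightarrow> g T \<subseteq> g S" if "S \<in> ?P" "T \<in> ?P" for S T
      using PE[OF that(1)] by (auto simp: g_def)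
    show "{} \<notin> g ` ?P" by (simp add: gP)
    \<comment> \<open>A basis avoided by \<open>U\<close> is avoided by every subset of
      \<open>U\<close>.\<close>
    show "V \<in> g ` ?P" if "U \<in> g ` ?P" "V \<subseteq> U" "V \<noteq> {}" for U V
      using that unfolding gP by blast
  qed simp
  moreover have "(\<Union>S\<in>?P. simplex_on (g S)) = (\<Union>F\<in>set (Ls @ Ms). simplex_on (set F))"
  proof -
    \<comment> \<open>The left-hand union runs over all faces, the right-hand one over the facets.
      They agree once each face lies in a facet (\<open>sub\<close>) and each facet is a face
      (\<open>mem\<close>).\<close>
    have sub: "\<exists>F\<in>set (Ls @ Ms). U \<subseteq> set F" if "U \<in> g ` ?P" for U
    proof -
      obtain a b c where abc: "a \<in> {1..<8}" "b \<in> {1..<8}" "c \<in> {1..<8}" "a \<noteq> b" "a \<noteq> c" "b \<noteq> c"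
          "\<not> fano_collinear a b c" "fano_point a \<notin> U" "fano_point b \<notin> U" "fano_point c \<notin> U"
        using \<open>U \<in> g ` ?P\<close> unfolding gP by blast
      then obtain F where F: "F \<in> set (cone_facets @ sphere_facets)" "{1..<8} - {a, b, c} \<subseteq> set F"
        using noncollinear_complement_facet unfolding set_upt by meson
      have "U \<subseteq> fano_point ` {1..<8}" using \<open>U \<in> g ` ?P\<close> unfolding gP fano_point_image by blast
      then have "U \<subseteq> fano_point ` ({1..<8} - {a, b, c})" using abc by blast
      also have "\<dots> \<subseteq> set (map fano_point F)" unfolding set_map by (intro image_mono F)
      finally have "U \<subseteq> set (map fano_point F)" .
      moreover have "map fano_point F \<in> set (Ls @ Ms)" using F(1) by (auto simp: Ls_def Ms_def)
      ultimately show ?thesis by blast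
    qed
    have mem: "set F \<in> g ` ?P" if "F \<in> set (Ls @ Ms)" for F
    proof -
      obtain H where H: "H \<in> set (cone_facets @ sphere_facets)" "F = map fano_point H"
        using \<open>F \<in> set (Ls @ Ms)\<close> by (auto simp: Ls_def Ms_def)
      have range: "set H \<subseteq> {1..<8}" "H \<noteq> []" using facet_in_range H(1) by auto
      obtain a b c where abc: "a \<in> {1..<8}" "b \<in> {1..<8}" "c \<in> {1..<8}" "a \<noteq> b" "a \<noteq> c" "b \<noteq> c"
          "\<not> fano_collinear a b c" "a \<notin> set H" "b \<notin> set H" "c \<notin> set H"
        using facet_complement_noncollinear H(1) unfolding set_upt by meson
      have "fano_point d \<notin> set F" if "d \<in> {1..<8}" "d \<notin> set H" for d
        using inj_on_image_mem_iff[OF inj_on_fano_point, of d "set H"] that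
          order_trans[OF range(1), of "{0..<8}"] by (auto simp: H(2))
      moreover have "set F \<subseteq> ?E" using range(1) unfolding H(2) set_map fano_point_image[symmetric] by blast
      moreover have "set F \<noteq> {}" using range(2) H(2) by simp
      ultimately show ?thesis unfolding gP using abc by blast
    qed
    show ?thesis
    proof (intro equalityI UN_least)
      fix S assume "S \<in> ?P"
      then obtain F where "F \<in> set (Ls @ Ms)" "g S \<subseteq> set F" using sub[of "g S"] by blast
      then show "simplex_on (g S) \<subseteq> (\<Union>F\<in>set (Ls @ Ms). simplex_on (set F))"
        using simplex_on_mono by blast
    next
      fix F assume "F \<in> set (Ls @ Ms)"
      then obtain S where "S \<in> ?P" "set F = g S" using mem[of F] by blast
      then show "simplex_on (set F) \<subseteq> (\<Union>S\<in>?P. simplex_on (g S))" by auto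
    qed
  qed
  moreover have "top_of_set (\<Union>F\<in>set (Ls @ Ms). simplex_on (set F)) homotopy_equivalent_space
      wedge_of_spheres (length Ms) 3"
  proof (rule homotopy_equivalent_wedge_of_spheres)
    have range: "set F \<subseteq> {0..<8}" if "F \<in> set (cone_facets @ sphere_facets)" for F
    proof -
      have "set F \<subseteq> {1..<8}" using bspec[OF facet_in_range that] by simp
      then show ?thesis by auto
    qed
    have inj: "inj_on fano_point (set F)" if "F \<in> set (cone_facets @ sphere_facets)" for F
      using inj_on_fano_point range[OF that] by (rule inj_on_subset)
    \<comment> \<open>Injectivity lets the inclusions and non-inclusions evaluated on numbers pass
      to vectors.\<close>
    have sub: "fano_point ` A \<subseteq> fano_point ` B \<longleftrightarrow> A \<subseteq> B" if "A \<subseteq> {0..<8}" "B \<subseteq> {0..<8}" for A B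
      using inj_on_image_mem_iff[OF inj_on_fano_point] that by blast
    show "cone_shelling (map set Ls)"
      using cone_shelling_map_image[OF cone_shelling_cone_facets, of fano_point]
        inj_on_subset[OF inj_on_fano_point, of "\<Union> (set (map set cone_facets))"] range
      by (auto simp: Ls_def o_def)
    show "Ms \<noteq> []" by (simp add: Ms_def sphere_facets_def)
    have "inj_on ((`) fano_point) (set (map set sphere_facets))"
      using sub range by (intro inj_onI) (auto simp: set_eq_subset)
    then show "distinct (map set Ms)"
      using sphere_facets_distinct distinct_map[of "(`) fano_point" "map set sphere_facets"]
      by (simp add: Ms_def o_def)
    fix F assume "F \<in> set Ms"
    then obtain H where H: "H \<in> set sphere_facets" "F = map fano_point H" by (auto simp: Ms_def)
    show "distinct F \<and> length F = Suc 3"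
      using H sphere_facets_boundary inj[of H] by (simp add: distinct_map)
    show "\<exists>G\<in>set Ls. set F - {v} \<subseteq> set G" if v: "v \<in> set F" for v
    proof -
      obtain u where u: "u \<in> set H" "v = fano_point u" using v H(2) by auto
      then obtain G where G: "G \<in> set cone_facets" "set H - {u} \<subseteq> set G"
        using sphere_facets_boundary H(1) by blast
      have "set F - {v} \<subseteq> fano_point ` (set H - {u})" using u H(2) by auto
      also have "\<dots> \<subseteq> set (map fano_point G)" unfolding set_map by (intro image_mono G)
      finally have "set F - {v} \<subseteq> set (map fano_point G)" .
      moreover have "map fano_point G \<in> set Ls" using G(1) by (auto simp: Ls_def)
      ultimately show ?thesis by blast
    qed
    fix G assume "G \<in> set Ls"
    then obtain G' where "G' \<in> set cone_facets" "G = map fano_point G'" by (auto simp: Ls_def)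
    then show "\<not> set F \<subseteq> set G"
      using sphere_facets_new H sub[of "set H" "set G'"] range by auto
  qed
  moreover have "length Ms = 8" by (simp add: Ms_def sphere_facets_def)
  ultimately show ?thesis
    by (metis homeomorphic_imp_homotopy_equivalent_space homotopy_eqv_trans)
qed

end
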